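(* Consider the Two-Stage Robust Matching problem (TSRM) in which all scenarios have the same size $k$. If the surplus $\ell=|D|-|R_1|-k$ is equal to zero, there exists a polynomial-time $\frac73$-approximation algorithm for TSRM; that is, a polynomial-time algorithm that, on every instance with zero surplus, outputs a feasible solution with total cost at most $\frac73\,OPT$.
   Context: TSRM: an instance consists of finite sets $D$ (drivers), $R_1$ (first-stage riders), $R_2$ (second-stage riders), an explicit list of scenarios $\mathcal{S}=\{S_1,\dots,S_q\}$ with $S_i\subseteq R_2$, and a (rational-valued) metric $d$ on $R_1\cup R_2\cup D$. A feasible solution is a set $D_1\subseteq D$ with $|D_1|=|R_1|$. Define $cost_1(D_1,R_1)$ as the total weight $\sum_{(i,j)\in M_1}d(i,j)$ of a minimum-weight perfect matching $M_1$ between $R_1$ and $D_1$, and, for a set of drivers $A$ and a scenario $S$, $cost_2(A,S)$ as the minimum total weight of a matching between $S$ and $A$ covering every element of $S$. The total cost of $D_1$, to be minimized, is $cost_1(D_1,R_1)+\max_{S\in\mathcal{S}}cost_2(D\setminus D_1,S)$; the optimal value is $OPT$. *)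

theory Defs
  imports
    "HOL-Computational_Algebra.Polynomial"
    "HOL-Library.Log_Nat"
begin

section \<open>Two-stage robust matching\<close>

text \<open>The sets of drivers and riders are not required to be disjoint: matchings below are
  sets of pairs whose components are tagged by their position, so an overlap is harmless.
  Scenarios form a list of sets; repetitions do not affect the cost.\<close>

record 'a tsrm =
  drivers :: "'a set"
  riders1 :: "'a set"
  riders2 :: "'a set"
  scenarios :: "'a set list"
  distance :: "'a \<Rightarrow> 'a \<Rightarrow> rat"

definition points :: "'a tsrm \<Rightarrow> 'a set" where
  "points I = riders1 I \<union> riders2 I \<union> drivers I"

text \<open>The library locale \<open>Metric_space\<close> is real-valued and constrains the distance function
  also outside the carrier, hence this relativised rational version.\<close>

definition metric_on :: "'a set \<Rightarrow> ('a \<Rightarrow> 'a \<Rightarrow> rat) \<Rightarrow> bool" where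
  "metric_on V d \<longleftrightarrow>
     (\<forall>x\<in>V. \<forall>y\<in>V. 0 \<le> d x y \<and> (d x y = 0 \<longleftrightarrow> x = y) \<and> d x y = d y x) \<and>
     (\<forall>x\<in>V. \<forall>y\<in>V. \<forall>z\<in>V. d x z \<le> d x y + d y z)"

definition tsrm_instance :: "'a tsrm \<Rightarrow> bool" where
  "tsrm_instance I \<longleftrightarrow>
     finite (drivers I) \<and> finite (riders1 I) \<and> finite (riders2 I) \<and>
     scenarios I \<noteq> [] \<and> (\<forall>S\<in>set (scenarios I). S \<subseteq> riders2 I) \<and>
     metric_on (points I) (distance I)"

definition uniform_scenarios :: "'a tsrm \<Rightarrow> nat \<Rightarrow> bool" where
  "uniform_scenarios I k \<longleftrightarrow> (\<forall>S\<in>set (scenarios I). card S = k)"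

definition surplus :: "'a tsrm \<Rightarrow> nat \<Rightarrow> int" where
  "surplus I k = int (card (drivers I)) - int (card (riders1 I)) - int k"

definition matching :: "'a set \<Rightarrow> 'b set \<Rightarrow> ('a \<times> 'b) set \<Rightarrow> bool" where
  "matching A B M \<longleftrightarrow> M \<subseteq> A \<times> B \<and> inj_on fst M \<and> inj_on snd M"

definition left_covering_matching :: "'a set \<Rightarrow> 'b set \<Rightarrow> ('a \<times> 'b) set \<Rightarrow> bool" where
  "left_covering_matching A B M \<longleftrightarrow> matching A B M \<and> fst ` M = A"

definition perfect_matching :: "'a set \<Rightarrow> 'b set \<Rightarrow> ('a \<times> 'b) set \<Rightarrow> bool" where
  "perfect_matching A B M \<longleftrightarrow> matching A B M \<and> fst ` M = A \<and> snd ` M = B"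

definition weight :: "('a \<Rightarrow> 'a \<Rightarrow> rat) \<Rightarrow> ('a \<times> 'a) set \<Rightarrow> rat" where
  "weight d M = (\<Sum>(i, j)\<in>M. d i j)"

text \<open>The minima and the maximum below range over finite sets. On zero-surplus instances with
  scenarios of equal size these sets are nonempty for every feasible solution.\<close>

definition cost1 :: "'a tsrm \<Rightarrow> 'a set \<Rightarrow> rat" where
  "cost1 I D1 = Min (weight (distance I) ` {M. perfect_matching (riders1 I) D1 M})"

definition cost2 :: "'a tsrm \<Rightarrow> 'a set \<Rightarrow> 'a set \<Rightarrow> rat" where
  "cost2 I A S = Min (weight (distance I) ` {M. left_covering_matching S A M})"

definition feasible :: "'a tsrm \<Rightarrow> 'a set \<Rightarrow> bool" where
  "feasible I D1 \<longleftrightarrow> D1 \<subseteq> drivers I \<and> card D1 = card (riders1 I)"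

definition total_cost :: "'a tsrm \<Rightarrow> 'a set \<Rightarrow> rat" where
  "total_cost I D1 =
     cost1 I D1 + Max ((\<lambda>S. cost2 I (drivers I - D1) S) ` set (scenarios I))"

definition OPT :: "'a tsrm \<Rightarrow> rat" where
  "OPT I = Min (total_cost I ` {D1. feasible I D1})"


section \<open>Programs with logarithmic cost\<close>

text \<open>The model of computation is a random access machine under the logarithmic cost criterion,
  presented with structured control flow. A program works on finitely many named arrays of
  unbounded integers; a scalar variable is an array used at index 0 only. Every operation is
  charged the bit lengths of all integers it handles, addresses included, so that time
  polynomial in the bit length of the input agrees with polynomial time on Turing machines.\<close>

type_synonym vname = string
type_synonym state = "vname \<Rightarrow> int \<Rightarrow> int"

datatype aexp =
    Lit int
  | Cell vname aexp
  | Add aexp aexp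
  | Sub aexp aexp
  | Mul aexp aexp
  | Div aexp aexp

datatype bexp = Less aexp aexp | Neg bexp | Conj bexp bexp

datatype com =
    Skip
  | Store vname aexp aexp
  | Seq com com
  | Cond bexp com com
  | While bexp com

text \<open>Binary digits of the absolute value, plus one for the sign. In particular the length is
  positive.\<close>

definition bits :: "int \<Rightarrow> nat" where
  "bits z = floorlog 2 (nat \<bar>z\<bar>) + 1"

primrec aval :: "aexp \<Rightarrow> state \<Rightarrow> int" where
  "aval (Lit c) s = c"
| "aval (Cell x a) s = s x (aval a s)"
| "aval (Add a b) s = aval a s + aval b s"
| "aval (Sub a b) s = aval a s - aval b s"
| "aval (Mul a b) s = aval a s * aval b s"
| "aval (Div a b) s = aval a s div aval b s"

primrec acost :: "aexp \<Rightarrow> state \<Rightarrow> nat" where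
  "acost (Lit c) s = bits c"
| "acost (Cell x a) s = acost a s + bits (aval a s) + bits (s x (aval a s))"
| "acost (Add a b) s = acost a s + acost b s + bits (aval a s) + bits (aval b s)"
| "acost (Sub a b) s = acost a s + acost b s + bits (aval a s) + bits (aval b s)"
| "acost (Mul a b) s = acost a s + acost b s + bits (aval a s) + bits (aval b s)"
| "acost (Div a b) s = acost a s + acost b s + bits (aval a s) + bits (aval b s)"

primrec bval :: "bexp \<Rightarrow> state \<Rightarrow> bool" where
  "bval (Less a b) s \<longleftrightarrow> aval a s < aval b s"
| "bval (Neg b) s \<longleftrightarrow> \<not> bval b s"
| "bval (Conj a b) s \<longleftrightarrow> bval a s \<and> bval b s"

primrec bcost :: "bexp \<Rightarrow> state \<Rightarrow> nat" where
  "bcost (Less a b) s = acost a s + acost b s + bits (aval a s) + bits (aval b s)"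
| "bcost (Neg b) s = bcost b s + 1"
| "bcost (Conj a b) s = bcost a s + bcost b s + 1"

text \<open>\<open>exec c s t s'\<close>: started in state \<open>s\<close>, the program \<open>c\<close> halts in state \<open>s'\<close> at cost \<open>t\<close>.\<close>

inductive exec :: "com \<Rightarrow> state \<Rightarrow> nat \<Rightarrow> state \<Rightarrow> bool" where
  Skip: "exec Skip s 1 s"
| Store: "exec (Store x a b) s
    (acost a s + acost b s + bits (aval a s) + bits (aval b s))
    (s(x := (s x)(aval a s := aval b s)))"
| Seq: "exec c s t s' \<Longrightarrow> exec c' s' t' s'' \<Longrightarrow> exec (Seq c c') s (t + t') s''"
| CondTrue: "bval b s \<Longrightarrow> exec c s t s' \<Longrightarrow> exec (Cond b c c') s (bcost b s + t) s'"
| CondFalse: "\<not> bval b s \<Longrightarrow> exec c' s t s' \<Longrightarrow> exec (Cond b c c') s (bcost b s + t) s'"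
| WhileFalse: "\<not> bval b s \<Longrightarrow> exec (While b c) s (bcost b s) s"
| WhileTrue: "bval b s \<Longrightarrow> exec c s t s' \<Longrightarrow> exec (While b c) s' t' s'' \<Longrightarrow>
    exec (While b c) s (bcost b s + t + t') s''"

inductive_cases SkipE: "exec Skip s t s'"
inductive_cases StoreE: "exec (Store x a b) s t s'"
inductive_cases SeqE: "exec (Seq c c') s t s'"
inductive_cases CondE: "exec (Cond b c c') s t s'"
inductive_cases WhileE: "exec (While b c) s t s'"

lemma exec_deterministic:
  "exec c s t s' \<Longrightarrow> exec c s u r \<Longrightarrow> u = t \<and> r = s'"
proof (induction arbitrary: u r rule: exec.induct)
  case Skip
  then show ?case by (auto elim: SkipE)
next
  case Store
  then show ?case by (auto elim: StoreE)
next
  case Seq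
  from Seq.prems show ?case by (rule SeqE) (use Seq.IH in blast)
next
  case CondTrue
  from CondTrue.prems show ?case by (rule CondE) (use CondTrue in blast)+
next
  case CondFalse
  from CondFalse.prems show ?case by (rule CondE) (use CondFalse in blast)+
next
  case WhileFalse
  from WhileFalse.prems show ?case by (rule WhileE) (use WhileFalse in blast)+
next
  case WhileTrue
  from WhileTrue.prems show ?case by (rule WhileE) (use WhileTrue in blast)+
qed

text \<open>A list is stored in an array with its length at index 0 and its entries from index 1 on.\<close>

definition array_of :: "int list \<Rightarrow> int \<Rightarrow> int" where
  "array_of xs i =
     (if i = 0 then int (length xs)
      else if 1 \<le> i \<and> i \<le> int (length xs) then xs ! nat (i - 1)
      else 0)"

definition holds_list :: "(int \<Rightarrow> int) \<Rightarrow> int list \<Rightarrow> bool" where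
  "holds_list m ys \<longleftrightarrow>
     m 0 = int (length ys) \<and> (\<forall>i<length ys. m (int i + 1) = ys ! i)"

definition initial_state :: "int list \<Rightarrow> state" where
  "initial_state xs = (\<lambda>_ _. 0)(''in'' := array_of xs)"

definition outputs :: "com \<Rightarrow> int list \<Rightarrow> int list \<Rightarrow> bool" where
  "outputs P xs ys \<longleftrightarrow> (\<exists>t s. exec P (initial_state xs) t s \<and> holds_list (s ''out'') ys)"

definition input_size :: "int list \<Rightarrow> nat" where
  "input_size xs = sum_list (map bits xs)"

definition polynomial_time_on :: "com \<Rightarrow> int list set \<Rightarrow> bool" where
  "polynomial_time_on P X \<longleftrightarrow>
     (\<exists>p :: nat poly. \<forall>xs\<in>X. \<exists>t s.
        exec P (initial_state xs) t s \<and> t \<le> poly p (input_size xs))"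


section \<open>Input and output format\<close>

text \<open>Points are referred to by their position in an enumeration \<open>pts\<close> of all points. Each
  distance is given by the numerator and the denominator of the reduced fraction.\<close>

definition enumerates :: "'a list \<Rightarrow> 'a tsrm \<Rightarrow> bool" where
  "enumerates pts I \<longleftrightarrow> distinct pts \<and> set pts = points I"

definition index_list :: "'a list \<Rightarrow> 'a set \<Rightarrow> int list" where
  "index_list pts A = map int (filter (\<lambda>i. pts ! i \<in> A) [0..<length pts])"

definition encode_set :: "'a list \<Rightarrow> 'a set \<Rightarrow> int list" where
  "encode_set pts A = int (length (index_list pts A)) # index_list pts A"

definition encode_rat :: "rat \<Rightarrow> int list" where
  "encode_rat r = [fst (quotient_of r), snd (quotient_of r)]"

definition encode :: "'a list \<Rightarrow> 'a tsrm \<Rightarrow> int list" where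
  "encode pts I =
     int (length pts) #
     concat (map (\<lambda>x. concat (map (\<lambda>y. encode_rat (distance I x y)) pts)) pts) @
     encode_set pts (drivers I) @ encode_set pts (riders1 I) @ encode_set pts (riders2 I) @
     int (length (scenarios I)) # concat (map (encode_set pts) (scenarios I))"

end

theory Submission imports Defs begin

text \<open>Let \<open>S\<close> be any scenario, and let \<open>x\<close> and \<open>y\<close> be the costs of matching the first-stage riders to
  \<open>D1\<close> and \<open>S\<close> to the remaining drivers. Minimise \<open>3 x + y\<close>, which is a single assignment problem
  because there is no surplus. Let \<open>x*\<close> and \<open>y*\<close> be the corresponding costs for an optimal solution
  \<open>D2\<close>. Going through the first-stage riders, \<open>D1\<close> can be moved onto \<open>D2\<close> at cost \<open>x + x*\<close>, and
  then so can the complement of \<open>D2\<close> onto that of \<open>D1\<close>; going through \<open>S\<close>, the latter costs at most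
  \<open>y + y*\<close>. Averaging both bounds, the total cost of \<open>D1\<close> is at most
  \<open>x + OPT2 + (x + x* + y + y*) / 2\<close>, where \<open>OPT2\<close> is the second-stage part of the optimum. This is
  at most \<open>2 x* + 2 OPT2\<close> by minimality, so the ratio is even 2.

  The assignment problem is solved by the Hungarian method after multiplication by the product of
  all denominators. Running times need no separate analysis: all loops run once per input number
  and numbers are multiplied by input entries only, which makes every such program polynomial.\<close>

section \<open>Loop programs run in polynomial time\<close>

text \<open>The weight 3 and the equal averaging come from balancing two terms. Weighting the two
  detours by \<lambda> and 1 - \<lambda> bounds the cost by (1 + \<lambda>) x + (1 - \<lambda>) y
  plus terms of the optimum. Minimising exactly this combination and using y* \<le> OPT2 leaves (1 +
  2 \<lambda>) x* + (3 - 2 \<lambda>) OPT2. The coefficients agree for \<lambda> = 1/2, where the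
  objective is 3 x + y up to a factor and the ratio is 2. One scenario is enough to choose
  \<open>D1\<close>, because the cost of carrying the complement of \<open>D2\<close> to that of
  \<open>D1\<close> does not depend on the scenario that occurs; every scenario pays it on top of
  its share of the optimum. Loops of fixed length have a price: the Hungarian method cannot leave a
  search early. Its growing and augmenting steps are therefore guarded by a flag and idle once their
  work is done, and the invariants must show that as many iterations as there are input numbers
  suffice.\<close>

datatype prog =
    Nop
  | Assign vname aexp aexp
  | Block prog prog
  | Branch bexp prog prog
  | For vname prog

definition tick :: "vname \<Rightarrow> state \<Rightarrow> state" where
  "tick x s = s(x := (s x)(0 := s x 0 + 1))"

primrec compile :: "prog \<Rightarrow> com" where
  "compile Nop = Skip"
| "compile (Assign x a b) = Store x a b"
| "compile (Block c c') = Seq (compile c) (compile c')"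
| "compile (Branch b c c') = Cond b (compile c) (compile c')"
| "compile (For x c) =
     Seq (Store x (Lit 0) (Lit 0))
       (While (Less (Cell x (Lit 0)) (Cell ''in'' (Lit 0)))
          (Seq (compile c) (Store x (Lit 0) (Add (Cell x (Lit 0)) (Lit 1)))))"

primrec sem :: "prog \<Rightarrow> state \<Rightarrow> state" where
  "sem Nop s = s"
| "sem (Assign x a b) s = s(x := (s x)(aval a s := aval b s))"
| "sem (Block c c') s = sem c' (sem c s)"
| "sem (Branch b c c') s = (if bval b s then sem c s else sem c' s)"
| "sem (For x c) s =
     ((\<lambda>r. tick x (sem c r)) ^^ nat (s ''in'' 0)) (s(x := (s x)(0 := 0)))"

primrec writes :: "prog \<Rightarrow> vname set" where
  "writes Nop = {}"
| "writes (Assign x a b) = {x}"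
| "writes (Block c c') = writes c \<union> writes c'"
| "writes (Branch b c c') = writes c \<union> writes c'"
| "writes (For x c) = insert x (writes c)"

text \<open>Products may only be formed with an input entry. Hence each assignment adds to the bit
  length of the largest stored number at most a multiple of the bit length of the input.\<close>

primrec safe :: "aexp \<Rightarrow> bool" where
  "safe (Lit c) \<longleftrightarrow> True"
| "safe (Cell x a) \<longleftrightarrow> safe a"
| "safe (Add a b) \<longleftrightarrow> safe a \<and> safe b"
| "safe (Sub a b) \<longleftrightarrow> safe a \<and> safe b"
| "safe (Mul a b) \<longleftrightarrow> safe a \<and> safe b \<and> (\<exists>e. a = Cell ''in'' e)"
| "safe (Div a b) \<longleftrightarrow> safe a \<and> safe b"

primrec bsafe :: "bexp \<Rightarrow> bool" where
  "bsafe (Less a b) \<longleftrightarrow> safe a \<and> safe b"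
| "bsafe (Neg b) \<longleftrightarrow> bsafe b"
| "bsafe (Conj a b) \<longleftrightarrow> bsafe a \<and> bsafe b"

primrec wf_prog :: "prog \<Rightarrow> bool" where
  "wf_prog Nop \<longleftrightarrow> True"
| "wf_prog (Assign x a b) \<longleftrightarrow> safe a \<and> safe b"
| "wf_prog (Block c c') \<longleftrightarrow> wf_prog c \<and> wf_prog c'"
| "wf_prog (Branch b c c') \<longleftrightarrow> bsafe b \<and> wf_prog c \<and> wf_prog c'"
| "wf_prog (For x c) \<longleftrightarrow> wf_prog c \<and> x \<notin> writes c"

text \<open>Literals count with their absolute value instead of their bit length. This is harmless,
  since the size is a constant of the program, and it makes |c| < 2 ^ \<open>asize (Lit c)\<close>
  immediate.\<close>

primrec asize :: "aexp \<Rightarrow> nat" where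
  "asize (Lit c) = nat \<bar>c\<bar> + 1"
| "asize (Cell x a) = asize a + 1"
| "asize (Add a b) = asize a + asize b + 1"
| "asize (Sub a b) = asize a + asize b + 1"
| "asize (Mul a b) = asize a + asize b + 1"
| "asize (Div a b) = asize a + asize b + 1"

primrec bsize :: "bexp \<Rightarrow> nat" where
  "bsize (Less a b) = asize a + asize b + 1"
| "bsize (Neg b) = bsize b + 1"
| "bsize (Conj a b) = bsize a + bsize b + 1"

primrec psize :: "prog \<Rightarrow> nat" where
  "psize Nop = 1"
| "psize (Assign x a b) = asize a + asize b + 1"
| "psize (Block c c') = psize c + psize c'"
| "psize (Branch b c c') = bsize b + psize c + psize c'"
| "psize (For x c) = psize c + 8"

text \<open>An upper bound on the number of assignments and tests when every loop runs
  \<open>L\<close> times. Both branches are added up, so that the bound does not depend on the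
  state.\<close>

primrec steps :: "prog \<Rightarrow> nat \<Rightarrow> nat" where
  "steps Nop L = 1"
| "steps (Assign x a b) L = 1"
| "steps (Block c c') L = steps c L + steps c' L"
| "steps (Branch b c c') L = 1 + steps c L + steps c' L"
| "steps (For x c) L = 2 + L * (steps c L + 2)"

lemma bits_le: "\<bar>z\<bar> < 2 ^ e \<Longrightarrow> bits z \<le> e + 1"
proof -
  assume "\<bar>z\<bar> < 2 ^ e"
  then have "nat \<bar>z\<bar> < 2 ^ e" by (simp add: nat_less_iff)
  then show ?thesis unfolding bits_def by (simp add: floorlog_leI)
qed

lemma abs_less_bits: "\<bar>z\<bar> < 2 ^ bits z"
proof (cases "z = 0")
  case False
  have "nat \<bar>z\<bar> < 2 ^ floorlog 2 (nat \<bar>z\<bar>)"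
    using floorlog_bounds[of "nat \<bar>z\<bar>" 2] False by simp
  then have "\<bar>z\<bar> < 2 ^ floorlog 2 (nat \<bar>z\<bar>)" by (simp add: nat_less_iff)
  also have "\<dots> \<le> 2 ^ bits z" by (simp add: bits_def)
  finally show ?thesis .
qed (simp add: bits_def)

lemma abs_div_le: "\<bar>x div y\<bar> \<le> \<bar>x\<bar>" for x y :: int
proof (cases "y = 0")
  case False
  have "\<bar>x div y\<bar> \<le> \<bar>x\<bar> " if "0 < y" for x y :: int
  proof (cases "0 \<le> x")
    case True
    then show ?thesis using that zdiv_mono2[of x 1 y] by (simp add: pos_imp_zdiv_nonneg_iff)
  next
    case False
    then have "x \<le> x div y" using that zdiv_mono2_neg[of x 1 y] by simp
    moreover have "x div y < 0" using False that by (simp add: div_neg_pos_less0)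
    ultimately show ?thesis by simp
  qed
  from this[of y x] this[of "-y" "-x"] False show ?thesis by (cases "0 < y") auto
qed simp

text \<open>Two bounds are kept apart because input entries never change: \<open>B\<close> stays
  fixed, while \<open>m\<close> increases during the run. A product with an input entry then costs
  only \<open>B\<close> further bits.\<close>

locale bounded_state =
  fixes s :: state and B m :: nat
  assumes input_bound: "\<bar>s ''in'' i\<bar> < 2 ^ B" and state_bound: "\<bar>s x i\<bar> < 2 ^ m"
begin

text \<open>Each node of the expression contributes at most \<open>B + 1\<close> bits: one for a sum
  or difference, at most \<open>B\<close> for a product because its left factor is an input entry,
  none for a quotient.\<close>

lemma aval_bound: "safe a \<Longrightarrow> \<bar>aval a s\<bar> < 2 ^ (m + asize a * (B + 1))"
proof (induction a)
  case (Lit c)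
  have "\<bar>c\<bar> < 2 ^ nat \<bar>c\<bar>"
    by (metis abs_ge_zero int_nat_eq of_nat_less_two_power)
  also have "\<dots> \<le> (2::int) ^ (m + asize (Lit c) * (B + 1))"
    by (intro power_increasing) (auto simp: algebra_simps)
  finally show ?case by simp
next
  case (Cell x a)
  have "\<bar>s x (aval a s)\<bar> < 2 ^ m" by (rule state_bound)
  also have "\<dots> \<le> 2 ^ (m + asize (Cell x a) * (B + 1))" by (intro power_increasing) auto
  finally show ?case by simp
next
  case (Add a b)
  let ?e = "m + (asize a + asize b) * (B + 1)"
  have "\<bar>aval a s\<bar> < 2 ^ (m + asize a * (B + 1))" "\<bar>aval b s\<bar> < 2 ^ (m + asize b * (B + 1))"
    using Add by auto
  moreover have "(2::int) ^ (m + asize a * (B + 1)) \<le> 2 ^ ?e" "(2::int) ^ (m + asize b * (B + 1)) \<le> 2 ^ ?e"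
    by (intro power_increasing; auto simp: algebra_simps)+
  moreover have "(2::int) * 2 ^ ?e \<le> 2 ^ (m + asize (Add a b) * (B + 1))"
    unfolding power_Suc[symmetric] by (intro power_increasing) (auto simp: algebra_simps)
  ultimately have "\<bar>aval a s + aval b s\<bar> < 2 ^ (m + asize (Add a b) * (B + 1))" by linarith
  then show ?case by (simp only: aval.simps)
next
  case (Sub a b)
  let ?e = "m + (asize a + asize b) * (B + 1)"
  have "\<bar>aval a s\<bar> < 2 ^ (m + asize a * (B + 1))" "\<bar>aval b s\<bar> < 2 ^ (m + asize b * (B + 1))"
    using Sub by auto
  moreover have "(2::int) ^ (m + asize a * (B + 1)) \<le> 2 ^ ?e" "(2::int) ^ (m + asize b * (B + 1)) \<le> 2 ^ ?e"
    by (intro power_increasing; auto simp: algebra_simps)+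
  moreover have "(2::int) * 2 ^ ?e \<le> 2 ^ (m + asize (Sub a b) * (B + 1))"
    unfolding power_Suc[symmetric] by (intro power_increasing) (auto simp: algebra_simps)
  ultimately have "\<bar>aval a s - aval b s\<bar> < 2 ^ (m + asize (Sub a b) * (B + 1))" by linarith
  then show ?case by (simp only: aval.simps)
next
  case (Mul a b)
  have "\<bar>aval b s\<bar> < 2 ^ (m + asize b * (B + 1))" and "\<bar>aval a s\<bar> < 2 ^ B"
    using Mul input_bound by auto
  then have "\<bar>aval a s\<bar> * \<bar>aval b s\<bar> < 2 ^ B * 2 ^ (m + asize b * (B + 1))"
    by (intro mult_strict_mono') auto
  also have "\<dots> \<le> 2 ^ (m + asize (Mul a b) * (B + 1))"
    unfolding power_add[symmetric] by (intro power_increasing) (auto simp: algebra_simps)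
  finally show ?case by (simp add: abs_mult)
next
  case (Div a b)
  have "\<bar>aval a s div aval b s\<bar> \<le> \<bar>aval a s\<bar>" by (rule abs_div_le)
  also have "\<dots> < 2 ^ (m + asize a * (B + 1))" using Div by simp
  also have "\<dots> \<le> 2 ^ (m + asize (Div a b) * (B + 1))"
    by (intro power_increasing) (auto simp: algebra_simps)
  finally show ?case by simp
qed

context
  fixes K M :: nat
  assumes M: "m + K * (B + 1) \<le> M"
begin

lemma aval_bound': "safe a \<Longrightarrow> asize a \<le> K \<Longrightarrow> \<bar>aval a s\<bar> < 2 ^ M"
proof -
  assume a: "safe a" "asize a \<le> K"
  have "\<bar>aval a s\<bar> < 2 ^ (m + asize a * (B + 1))" using a(1) by (rule aval_bound)
  also have "\<dots> \<le> 2 ^ M" 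
    by (intro power_increasing order.trans[OF _ M] add_left_mono mult_right_mono a) auto
  finally show ?thesis .
qed

lemma bits_aval: "safe a \<Longrightarrow> asize a \<le> K \<Longrightarrow> bits (aval a s) \<le> M + 1"
  by (intro bits_le aval_bound')

lemma acost_bound: "safe a \<Longrightarrow> asize a \<le> K \<Longrightarrow> acost a s \<le> 2 * asize a * (M + 1)"
proof (induction a)
  case (Lit c)
  then show ?case using bits_aval[of "Lit c"] by simp
next
  case (Cell x a)
  then show ?case using bits_aval[of a] bits_aval[of "Cell x a"] by simp
next
  case (Add a b)
  then show ?case using bits_aval[of a] bits_aval[of b] by (simp add: algebra_simps)
next
  case (Sub a b)
  then show ?case using bits_aval[of a] bits_aval[of b] by (simp add: algebra_simps)
next
  case (Mul a b)
  then have "acost a s \<le> 2 * asize a * (M + 1)" "acost b s \<le> 2 * asize b * (M + 1)" 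
    "bits (aval a s) \<le> M + 1" "bits (aval b s) \<le> M + 1"
    using bits_aval[of a] bits_aval[of b] by auto
  then show ?case by (simp add: algebra_simps)
next
  case (Div a b)
  then show ?case using bits_aval[of a] bits_aval[of b] by (simp add: algebra_simps)
qed

lemma bcost_bound: "bsafe b \<Longrightarrow> bsize b \<le> K \<Longrightarrow> bcost b s \<le> 2 * bsize b * (M + 1)"
proof (induction b)
  case (Less a b)
  then show ?case
    using bits_aval[of a] bits_aval[of b] acost_bound[of a] acost_bound[of b]
    by (simp add: algebra_simps)
qed (auto simp: algebra_simps)

end

end

lemma bounded_state_mono: "bounded_state s B m \<Longrightarrow> m \<le> m' \<Longrightarrow> bounded_state s B m'"
  unfolding bounded_state_def by (meson order_less_le_trans one_le_numeral power_increasing)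

lemma sem_frame: "x \<notin> writes c \<Longrightarrow> sem c s x = s x"
proof (induction c arbitrary: s)
  case (For y c)
  have "((\<lambda>r. tick y (sem c r)) ^^ k) r x = r x" for k r
    by (induction k) (use For in \<open>auto simp: tick_def\<close>)
  then show ?case using For by simp
qed auto

lemma steps_mono: "L \<le> L' \<Longrightarrow> steps c L \<le> steps c L'"
  by (induction c) (auto intro: add_mono mult_le_mono)

text \<open>One step lengthens the stored numbers by at most \<open>K * (B + 1)\<close> bits and, as
  long as \<open>M\<close> bounds all bit lengths, costs at most \<open>4 * K * (M + 1)\<close>. The
  induction varies \<open>m\<close> but keeps \<open>M\<close> fixed, so the costs of consecutive
  parts simply add up.\<close>

lemma exec_compile:
  assumes "wf_prog c" "''in'' \<notin> writes c" "psize c \<le> K" "s ''in'' 0 = int L"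
    "bounded_state s B m" "m + steps c L * (K * (B + 1)) \<le> M"
  shows "\<exists>t. exec (compile c) s t (sem c s) \<and> t \<le> steps c L * (4 * K * (M + 1)) \<and>
    bounded_state (sem c s) B (m + steps c L * (K * (B + 1)))"
  using assms
proof (induction c arbitrary: s m)
  case Nop
  have "1 * (1 * 1) \<le> 4 * K * (M + 1)" using Nop by (intro mult_le_mono) auto
  moreover have "bounded_state s B (m + K * (B + 1))"
    using bounded_state_mono Nop.prems by simp
  ultimately show ?case using exec.Skip by fastforce
next
  case (Assign x a b)
  interpret bounded_state s B m by fact
  have K: "safe a" "safe b" "asize a \<le> K" "asize b \<le> K" "asize a + asize b + 1 \<le> K" "x \<noteq> ''in''"
    using Assign.prems by auto
  have M: "m + K * (B + 1) \<le> M" using Assign.prems by simp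
  have "acost a s + acost b s + bits (aval a s) + bits (aval b s)
      \<le> 2 * asize a * (M + 1) + 2 * asize b * (M + 1) + (M + 1) + (M + 1)"
    by (intro add_mono acost_bound[OF M] bits_aval[OF M] K)
  also have "\<dots> = 2 * (asize a + asize b + 1) * (M + 1)" by (simp add: algebra_simps)
  also have "\<dots> \<le> 4 * K * (M + 1)" using K by (intro mult_right_mono) auto
  finally have cost: "acost a s + acost b s + bits (aval a s) + bits (aval b s) \<le> 4 * K * (M + 1)" .
  have "bounded_state (s(x := (s x)(aval a s := aval b s))) B (m + K * (B + 1))"
  proof
    fix y i
    have "(2::int) ^ m \<le> 2 ^ (m + K * (B + 1))" by (intro power_increasing) auto
    then have "\<bar>s y i\<bar> < 2 ^ (m + K * (B + 1))" for y i
      using state_bound[of y i] by (meson order_less_le_trans)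
    then show "\<bar>(s(x := (s x)(aval a s := aval b s))) y i\<bar> < 2 ^ (m + K * (B + 1))"
      using aval_bound'[of K "m + K * (B + 1)" b] K by simp
  next
    fix i show "\<bar>(s(x := (s x)(aval a s := aval b s))) ''in'' i\<bar> < 2 ^ B"
      using K input_bound by simp
  qed
  with cost show ?case using exec.Store[of x a b s]
    unfolding compile.simps sem.simps steps.simps mult_1 by blast
next
  case (Block c c')
  let ?G = "K * (B + 1)"
  have M: "m + steps c L * ?G + steps c' L * ?G \<le> M" using Block.prems by (simp add: algebra_simps)
  obtain t where t: "exec (compile c) s t (sem c s)" "t \<le> steps c L * (4 * K * (M + 1))"
    "bounded_state (sem c s) B (m + steps c L * ?G)"
    using Block.IH(1)[of s m] Block.prems M by auto
  obtain t' where t': "exec (compile c') (sem c s) t' (sem c' (sem c s))"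
    "t' \<le> steps c' L * (4 * K * (M + 1))"
    "bounded_state (sem c' (sem c s)) B (m + steps c L * ?G + steps c' L * ?G)"
    using Block.IH(2)[of "sem c s" "m + steps c L * ?G"] Block.prems M t(3)
    by (auto simp: sem_frame)
  have "exec (compile (Block c c')) s (t + t') (sem (Block c c') s)"
    using exec.Seq[OF t(1) t'(1)] by simp
  moreover have "t + t' \<le> steps (Block c c') L * (4 * K * (M + 1))"
    using t t' by (simp add: algebra_simps)
  ultimately show ?case using t'(3) by (auto simp: algebra_simps)
next
  case (Branch b c c')
  let ?G = "K * (B + 1)"
  interpret bounded_state s B m by fact
  define d where "d = (if bval b s then c else c')"
  have M: "m + steps d L * ?G \<le> M" and "steps d L + 1 \<le> steps (Branch b c c') L"
    using Branch.prems by (auto simp: d_def algebra_simps)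
  then have d: "(steps d L + 1) * G \<le> steps (Branch b c c') L * G" for G by (intro mult_right_mono) auto
  obtain t where t: "exec (compile d) s t (sem d s)" "t \<le> steps d L * (4 * K * (M + 1))"
    "bounded_state (sem d s) B (m + steps d L * ?G)"
    using Branch.IH(1)[of s m] Branch.IH(2)[of s m] Branch.prems M by (cases "bval b s") (auto simp: d_def)
  have "m + K * (B + 1) \<le> m + steps (Branch b c c') L * ?G" by simp
  then have KM: "m + K * (B + 1) \<le> M" using Branch.prems by linarith
  have "bcost b s \<le> 2 * bsize b * (M + 1)"
    using Branch.prems by (intro bcost_bound[OF KM]) auto
  also have "\<dots> \<le> 4 * K * (M + 1)" using Branch.prems by (intro mult_right_mono) auto
  finally have b: "bcost b s \<le> 4 * K * (M + 1)" .
  have "exec (compile (Branch b c c')) s (bcost b s + t) (sem (Branch b c c') s)"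
    using t(1) exec.CondTrue[of b s] exec.CondFalse[of b s] by (cases "bval b s") (auto simp: d_def)
  moreover have "bcost b s + t \<le> steps (Branch b c c') L * (4 * K * (M + 1))"
    using d[of "4 * K * (M + 1)"] b t(2) by (simp add: algebra_simps)
  moreover have "bounded_state (sem (Branch b c c') s) B (m + steps (Branch b c c') L * ?G)"
  proof -
    have "steps d L * ?G \<le> steps (Branch b c c') L * ?G" using d[of ?G] by (simp add: algebra_simps)
    moreover have "sem (Branch b c c') s = sem d s" by (auto simp: d_def)
    ultimately show ?thesis using bounded_state_mono[OF t(3)] by simp
  qed
  ultimately show ?case by blast
next
  case (For x c)
  let ?G = "K * (B + 1)" and ?C = "4 * K * (M + 1)"
  let ?W = "While (Less (Cell x (Lit 0)) (Cell ''in'' (Lit 0)))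
          (Seq (compile c) (Store x (Lit 0) (Add (Cell x (Lit 0)) (Lit 1))))"
  let ?f = "\<lambda>r. tick x (sem c r)"
  let ?T = "\<lambda>k. 1 + k * (steps c L + 2)"
  have x: "x \<noteq> ''in''" "x \<notin> writes c" "''in'' \<notin> writes c" "wf_prog c" and K: "psize c \<le> K" "8 \<le> K"
    using For.prems by auto
  have guard: "bcost (Less (Cell x (Lit 0)) (Cell ''in'' (Lit 0))) r \<le> ?C"
    if "bounded_state r B m'" "m' + ?G \<le> M" for r m'
  proof -
    interpret bounded_state r B m' by fact
    have "bcost (Less (Cell x (Lit 0)) (Cell ''in'' (Lit 0))) r \<le> 2 * 5 * (M + 1)"
      using bcost_bound[OF that(2), of "Less (Cell x (Lit 0)) (Cell ''in'' (Lit 0))"] K 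
      by (simp del: bcost.simps)
    also have "\<dots> \<le> ?C" using K by (intro mult_right_mono) auto
    finally show ?thesis .
  qed
  have store: "acost (Lit 0) r + acost e r + bits (aval (Lit 0) r) + bits (aval e r) \<le> ?C \<and>
      bounded_state (r(x := (r x)(0 := aval e r))) B (m' + ?G)"
    if "bounded_state r B m'" "m' + ?G \<le> M" "safe e" "asize e \<le> 5" for r m' e
  proof -
    interpret bounded_state r B m' by fact
    have "acost e r \<le> 2 * 5 * (M + 1)" 
    proof -
      have "acost e r \<le> 2 * asize e * (M + 1)" using that K by (intro acost_bound[OF that(2)]) auto
      also have "\<dots> \<le> 2 * 5 * (M + 1)" using that by (intro mult_right_mono mult_left_mono) auto
      finally show ?thesis .
    qed
    moreover have "acost (Lit 0) r \<le> 2 * asize (Lit 0) * (M + 1)"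
      "bits (aval (Lit 0) r) \<le> M + 1" "bits (aval e r) \<le> M + 1"
      using K that by (intro acost_bound[OF that(2)] bits_aval[OF that(2)]; simp)+
    ultimately have "acost (Lit 0) r + acost e r + bits (aval (Lit 0) r) + bits (aval e r) \<le> 14 * (M + 1)"
      by simp
    also have "\<dots> \<le> ?C" using K by (intro mult_right_mono) auto
    finally have 1: "acost (Lit 0) r + acost e r + bits (aval (Lit 0) r) + bits (aval e r) \<le> ?C" .
    have "bounded_state (r(x := (r x)(0 := aval e r))) B (m' + ?G)"
    proof
      fix y i
      have "(2::int) ^ m' \<le> 2 ^ (m' + ?G)" by (intro power_increasing) auto
      then have "\<bar>r y i\<bar> < 2 ^ (m' + ?G)" for y i
        using state_bound[of y i] by (meson order_less_le_trans)
      then show "\<bar>(r(x := (r x)(0 := aval e r))) y i\<bar> < 2 ^ (m' + ?G)"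
        using aval_bound'[of K "m' + ?G" e] that K by simp
    next
      fix i show "\<bar>(r(x := (r x)(0 := aval e r))) ''in'' i\<bar> < 2 ^ B"
        using x input_bound by simp
    qed
    with 1 show ?thesis by blast
  qed
  \<comment> \<open>Here \<open>k\<close> is the number of remaining iterations, so the counter
    stands at \<open>L - k\<close>. This fits \<open>exec\<close>, which unfolds a loop at its
    front.\<close>
  have loop: "\<exists>t. exec ?W r t ((?f ^^ k) r) \<and> t \<le> ?T k * ?C \<and>
      bounded_state ((?f ^^ k) r) B (m' + ?T k * ?G)"
    if "r ''in'' 0 = int L" "r x 0 = int L - int k" "bounded_state r B m'" "m' + ?T k * ?G \<le> M"
    for r k m'
    using that
  proof (induction k arbitrary: r m')
    case 0
    have "bcost (Less (Cell x (Lit 0)) (Cell ''in'' (Lit 0))) r \<le> ?C"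
      using 0 by (intro guard[of r m']) auto
    moreover have "bounded_state r B (m' + ?G)"
      using bounded_state_mono 0 by simp
    moreover have "exec ?W r (bcost (Less (Cell x (Lit 0)) (Cell ''in'' (Lit 0))) r) r"
      using 0 by (intro exec.WhileFalse) simp
    ultimately show ?case by auto
  next
    case (Suc k)
    have T: "?T (Suc k) * ?G = steps c L * ?G + ?G + ?G + ?T k * ?G" by (simp add: algebra_simps)
    obtain t where t: "exec (compile c) r t (sem c r)" "t \<le> steps c L * ?C"
      "bounded_state (sem c r) B (m' + steps c L * ?G)"
      using For.IH[of r m'] x K Suc.prems T by auto
    have "m' + steps c L * ?G + ?G \<le> M" using Suc.prems T by linarith
    from store[OF t(3) this, of "Add (Cell x (Lit 0)) (Lit 1)"]
    obtain t' where t': "exec (Store x (Lit 0) (Add (Cell x (Lit 0)) (Lit 1))) (sem c r) t' (?f r)"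
      "t' \<le> ?C" "bounded_state (?f r) B (m' + steps c L * ?G + ?G)"
      using exec.Store[of x "Lit 0" "Add (Cell x (Lit 0)) (Lit 1)" "sem c r"]
      by (auto simp: tick_def)
    have fr: "?f r ''in'' 0 = int L" "?f r x 0 = int L - int k"
      using x Suc.prems by (auto simp: tick_def sem_frame)
    have bs: "bounded_state (?f r) B (m' + steps c L * ?G + ?G + ?G)"
      using bounded_state_mono[OF t'(3)] by simp
    obtain t'' where t'': "exec ?W (?f r) t'' ((?f ^^ k) (?f r))" "t'' \<le> ?T k * ?C"
      "bounded_state ((?f ^^ k) (?f r)) B (m' + steps c L * ?G + ?G + ?G + ?T k * ?G)"
      using Suc.IH[OF fr bs] Suc.prems T by auto
    let ?b = "bcost (Less (Cell x (Lit 0)) (Cell ''in'' (Lit 0))) r"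
    have b: "?b \<le> ?C" using Suc.prems T by (intro guard[of r m']) auto
    have "exec ?W r (?b + (t + t') + t'') ((?f ^^ k) (?f r))"
      using Suc.prems t''(1) exec.Seq[OF t(1) t'(1)] by (intro exec.WhileTrue) auto
    moreover have "(?f ^^ k) (?f r) = (?f ^^ Suc k) r" by (simp only: funpow_Suc_right o_def)
    moreover have "?b + (t + t') + t'' \<le> ?T (Suc k) * ?C"
    proof -
      have "?T (Suc k) * ?C = steps c L * ?C + ?C + ?C + ?T k * ?C" by (simp add: algebra_simps)
      then show ?thesis using b t(2) t'(2) t''(2) by linarith
    qed
    moreover have "m' + steps c L * ?G + ?G + ?G + ?T k * ?G = m' + ?T (Suc k) * ?G"
      using T by linarith
    ultimately show ?case using t''(3) by metis
  qed
  let ?s = "s(x := (s x)(0 := 0))"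
  have S: "steps (For x c) L * G = G + ?T L * G" for G by (simp add: algebra_simps)
  have M: "m + ?G + ?T L * ?G \<le> M" using For.prems(6) S[of ?G] by linarith
  have "m + ?G \<le> M" using M by linarith
  from store[OF For.prems(5) this, of "Lit 0"]
  obtain t where t: "exec (Store x (Lit 0) (Lit 0)) s t ?s" "t \<le> ?C"
    "bounded_state ?s B (m + ?G)"
    using exec.Store[of x "Lit 0" "Lit 0" s] by auto
  obtain t' where t': "exec ?W ?s t' ((?f ^^ L) ?s)" "t' \<le> ?T L * ?C"
      "bounded_state ((?f ^^ L) ?s) B (m + ?G + ?T L * ?G)"
    using loop[of ?s L "m + ?G"] x For.prems M t by auto
  have "sem (For x c) s = (?f ^^ L) ?s" using For.prems by simp
  moreover have "exec (compile (For x c)) s (t + t') ((?f ^^ L) ?s)"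
    using exec.Seq[OF t(1) t'(1)] by simp
  moreover have "t + t' \<le> steps (For x c) L * ?C" using t t' S[of ?C] by linarith
  moreover have "m + ?G + ?T L * ?G = m + steps (For x c) L * ?G" using S[of ?G] by linarith
  ultimately show ?case using t'(3) by metis
qed

lemma steps_poly: "\<exists>p :: nat poly. \<forall>L. steps c L = poly p L"
proof (induction c)
  case Nop
  show ?case by (intro exI[of _ "[:1:]"]) simp
next
  case Assign
  show ?case by (intro exI[of _ "[:1:]"]) simp
next
  case (Block c c')
  then obtain p q :: "nat poly" where "\<forall>L. steps c L = poly p L" "\<forall>L. steps c' L = poly q L" by blast
  then show ?case by (intro exI[of _ "p + q"]) simp
next
  case (Branch b c c')
  then obtain p q :: "nat poly" where "\<forall>L. steps c L = poly p L" "\<forall>L. steps c' L = poly q L" by blast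
  then show ?case by (intro exI[of _ "[:1:] + p + q"]) simp
next
  case (For x c)
  then obtain p :: "nat poly" where "\<forall>L. steps c L = poly p L" by blast
  then show ?case by (intro exI[of _ "[:2:] + [:0, 1:] * (p + [:2:])"]) simp
qed

lemma bits_pos: "0 < bits z"
  by (simp add: bits_def)

lemma length_le_input_size: "length xs \<le> input_size xs"
  by (induction xs) (use bits_pos in \<open>auto simp: input_size_def Suc_le_eq add_strict_increasing\<close>)

lemma bounded_initial: "bounded_state (initial_state xs) (input_size xs) (input_size xs)"
proof
  fix i x
  let ?S = "input_size xs"
  have "\<bar>array_of xs i\<bar> < 2 ^ ?S"
  proof -
    have "int (length xs) < 2 ^ ?S"
      using length_le_input_size[of xs] of_nat_less_two_power[of ?S, where 'a = int] by linarith
    moreover have "\<bar>xs ! j\<bar> < 2 ^ ?S" if "j < length xs" for j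
    proof -
      have "bits (xs ! j) \<le> ?S"
        unfolding input_size_def using that by (intro member_le_sum_list) auto
      then have "(2::int) ^ bits (xs ! j) \<le> 2 ^ ?S" by (intro power_increasing) auto
      then show ?thesis using abs_less_bits[of "xs ! j"] by linarith
    qed
    ultimately show ?thesis by (auto simp: array_of_def nat_less_iff)
  qed
  then show "\<bar>initial_state xs ''in'' i\<bar> < 2 ^ ?S" "\<bar>initial_state xs x i\<bar> < 2 ^ ?S"
    by (auto simp: initial_state_def)
qed

text \<open>The input size serves three purposes: it bounds the bit length of the input entries,
  that of all initial cells, and the number of loop iterations, which is the length of the input
  list.\<close>

lemma exec_initial:
  assumes "wf_prog c" "''in'' \<notin> writes c"
  defines "K \<equiv> psize c"
  shows "\<exists>t. exec (compile c) (initial_state xs) t (sem c (initial_state xs)) \<and>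
    t \<le> steps c (input_size xs) * (4 * K * (input_size xs +
      steps c (input_size xs) * (K * (input_size xs + 1)) + 1))"
proof -
  let ?S = "input_size xs" and ?L = "length xs"
  let ?M = "?S + steps c ?S * (K * (?S + 1))"
  have st: "steps c ?L \<le> steps c ?S" by (intro steps_mono length_le_input_size)
  then have "steps c ?L * (K * (?S + 1)) \<le> steps c ?S * (K * (?S + 1))" by (intro mult_right_mono) auto
  then obtain t where t: "exec (compile c) (initial_state xs) t (sem c (initial_state xs))"
    "t \<le> steps c ?L * (4 * K * (?M + 1))"
    using exec_compile[OF assms(1,2), of K "initial_state xs" ?L ?S ?S ?M] bounded_initial[of xs]
    by (auto simp: K_def initial_state_def array_of_def)
  moreover have "steps c ?L * (4 * K * (?M + 1)) \<le> steps c ?S * (4 * K * (?M + 1))"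
    using st by (intro mult_right_mono) auto
  ultimately show ?thesis using order.trans by blast
qed

lemma polynomial_time_compile:
  assumes "wf_prog c" "''in'' \<notin> writes c"
  shows "polynomial_time_on (compile c) X"
proof -
  obtain p :: "nat poly" where p: "\<forall>L. steps c L = poly p L" using steps_poly by blast
  let ?K = "psize c"
  let ?X = "[:0, 1:] :: nat poly"
  let ?q = "p * (smult (4 * ?K) (?X + p * smult ?K (?X + 1) + 1))"
  have "poly ?q S = steps c S * (4 * ?K * (S + steps c S * (?K * (S + 1)) + 1))" for S
    by (simp add: p mult.left_commute distrib_left)
  then show ?thesis unfolding polynomial_time_on_def using exec_initial[OF assms] by metis
qed

lemma outputs_compile:
  assumes "wf_prog c" "''in'' \<notin> writes c" "holds_list (sem c (initial_state xs) ''out'') ys"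
  shows "outputs (compile c) xs ys"
  unfolding outputs_def using exec_initial[OF assms(1,2)] assms(3) by blast

section \<open>The Hungarian method\<close>

abbreviation scalar :: "vname \<Rightarrow> aexp" where
  "scalar x \<equiv> Cell x (Lit 0)"

abbreviation assign :: "vname \<Rightarrow> aexp \<Rightarrow> prog" where
  "assign x a \<equiv> Assign x (Lit 0) a"

definition Eq :: "aexp \<Rightarrow> aexp \<Rightarrow> bexp" where
  "Eq a b = Conj (Neg (Less a b)) (Neg (Less b a))"

definition Or :: "bexp \<Rightarrow> bexp \<Rightarrow> bexp" where
  "Or a b = Neg (Conj (Neg a) (Neg b))"

lemma bval_Eq [simp]: "bval (Eq a b) s \<longleftrightarrow> aval a s = aval b s"
  by (auto simp: Eq_def)

lemma bval_Or [simp]: "bval (Or a b) s \<longleftrightarrow> bval a s \<or> bval b s"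
  by (auto simp: Or_def)

lemma bsafe_Eq [simp]: "bsafe (Eq a b) \<longleftrightarrow> safe a \<and> safe b"
  by (auto simp: Eq_def)

lemma bsafe_Or [simp]: "bsafe (Or a b) \<longleftrightarrow> bsafe a \<and> bsafe b"
  by (auto simp: Or_def)

definition For_upto :: "vname \<Rightarrow> vname \<Rightarrow> prog \<Rightarrow> prog" where
  "For_upto x v c = For x (Branch (Less (scalar x) (scalar v)) c Nop)"

lemma writes_For_upto [simp]: "writes (For_upto x v c) = insert x (writes c)"
  by (simp add: For_upto_def)

lemma wf_For_upto [simp]: "wf_prog (For_upto x v c) \<longleftrightarrow> wf_prog c \<and> x \<notin> writes c"
  by (simp add: For_upto_def)

text \<open>The counter is reset before the loop and incremented after each round, so
  \<open>I\<close> must survive arbitrary changes of the counter array; this is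
  \<open>indep\<close>. The current counter value is passed to \<open>I\<close> as an argument
  instead.\<close>

lemma For_rule:
  fixes I :: "int \<Rightarrow> state \<Rightarrow> bool"
  assumes "0 \<le> s ''in'' 0" "x \<notin> writes c" "x \<noteq> ''in''" "''in'' \<notin> writes c"
    and indep: "\<And>i r f. I i r \<Longrightarrow> I i (r(x := f))"
    and init: "I 0 s"
    and step: "\<And>i r. \<lbrakk>0 \<le> i; i < s ''in'' 0; I i r; r x 0 = i;
      \<And>z. z \<notin> insert x (writes c) \<Longrightarrow> r z = s z\<rbrakk> \<Longrightarrow> I (i + 1) (sem c r)"
  shows "I (s ''in'' 0) (sem (For x c) s)"
proof -
  let ?f = "\<lambda>r. tick x (sem c r)"
  define s' where "s' = s(x := (s x)(0 := 0))"
  have s': "I 0 s'" "s' x 0 = 0" "\<And>z. z \<noteq> x \<Longrightarrow> s' z = s z"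
    unfolding s'_def by (rule indep[OF init]) simp_all
  have "I (int k) ((?f ^^ k) s') \<and> (?f ^^ k) s' x 0 = int k \<and>
      (\<forall>z. z \<notin> insert x (writes c) \<longrightarrow> (?f ^^ k) s' z = s z)" if "k \<le> nat (s ''in'' 0)" for k
    using that
  proof (induction k)
    case 0
    show ?case using s' by simp
  next
    case (Suc k)
    let ?r = "(?f ^^ k) s'"
    have r: "I (int k) ?r" "?r x 0 = int k" "\<And>z. z \<notin> insert x (writes c) \<Longrightarrow> ?r z = s z"
      using Suc by auto
    have "I (int k + 1) (sem c ?r)" by (rule step) (use Suc.prems r in auto)
    then have "I (int k + 1) (?f ?r)" unfolding tick_def by (rule indep)
    moreover have "?f ?r x 0 = int k + 1" using r assms(2) by (simp add: tick_def sem_frame)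
    moreover have "?f ?r z = s z" if "z \<notin> insert x (writes c)" for z
      using that r by (simp add: tick_def sem_frame)
    ultimately show ?case by (simp add: add.commute)
  qed
  from this[of "nat (s ''in'' 0)"] assms(1) show ?thesis by (simp add: s'_def)
qed

lemma For_upto_rule:
  fixes I :: "int \<Rightarrow> state \<Rightarrow> bool"
  assumes N: "0 \<le> s v 0" "s v 0 \<le> s ''in'' 0"
    and vars: "x \<notin> writes c" "x \<noteq> ''in''" "''in'' \<notin> writes c" "v \<notin> insert x (writes c)"
    and indep: "\<And>i r f. I i r \<Longrightarrow> I i (r(x := f))"
    and init: "I 0 s"
    and step: "\<And>i r. \<lbrakk>0 \<le> i; i < s v 0; I i r; r x 0 = i;
      \<And>z. z \<notin> insert x (writes c) \<Longrightarrow> r z = s z\<rbrakk> \<Longrightarrow> I (i + 1) (sem c r)"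
  shows "I (s v 0) (sem (For_upto x v c) s)"
proof -
  \<comment> \<open>The loop goes on after the limit with an empty body; the truncated index freezes
    the invariant during these idle rounds.\<close>
  let ?J = "\<lambda>i. I (min i (s v 0))"
  have "?J (s ''in'' 0) (sem (For x (Branch (Less (scalar x) (scalar v)) c Nop)) s)"
  proof (rule For_rule)
    show "0 \<le> s ''in'' 0" using N by simp
    show "?J 0 s" using init N by simp
    fix i r assume A: "0 \<le> i" "i < s ''in'' 0" "?J i r" "r x 0 = i"
      "\<And>z. z \<notin> insert x (writes (Branch (Less (scalar x) (scalar v)) c Nop)) \<Longrightarrow> r z = s z"
    have v: "r v 0 = s v 0" using A(5)[of v] vars by simp
    show "?J (i + 1) (sem (Branch (Less (scalar x) (scalar v)) c Nop) r)"
    proof (cases "i < s v 0")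
      case True
      then show ?thesis using step[of i r] A v by (simp add: min_def)
    next
      case False
      then show ?thesis using A v by (simp add: min_absorb2)
    qed
  qed (use vars indep in \<open>auto simp del: fun_upd_apply\<close>)
  then show ?thesis using N by (simp add: For_upto_def min_absorb2 del: sem.simps)
qed

text \<open>The registers of a running minimum. The flag \<open>h\<close> replaces an initial value
  of infinity, which integer cells cannot store.\<close>

definition best_pair :: "('a \<Rightarrow> 'b \<Rightarrow> int) \<Rightarrow> ('a \<times> 'b) set \<Rightarrow> int \<Rightarrow> int \<Rightarrow> 'a \<Rightarrow> 'b \<Rightarrow> bool" where
  "best_pair w Z h d e g \<longleftrightarrow>
     h = 0 \<and> Z = {} \<or> h = 1 \<and> (e, g) \<in> Z \<and> d = w e g \<and> (\<forall>(i, j)\<in>Z. d \<le> w i j)"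

lemma best_pair_insert:
  assumes "best_pair w Z h d e g"
  shows "h = 0 \<or> w i j < d \<Longrightarrow> best_pair w (insert (i, j) Z) 1 (w i j) i j"
    and "\<not> (h = 0 \<or> w i j < d) \<Longrightarrow> best_pair w (insert (i, j) Z) h d e g"
  using assms unfolding best_pair_def by fastforce+

section \<open>Primal-dual invariants for the assignment problem\<close>

locale assignment =
  fixes N :: int and C :: "int \<Rightarrow> int \<Rightarrow> int"
  assumes N_nonneg: "0 \<le> N" and cost_nonneg: "\<lbrakk>0 \<le> i; i < N; 0 \<le> j; j < N\<rbrakk> \<Longrightarrow> 0 \<le> C i j"
begin

text \<open>Linear programming duality with the column potentials negated: \<open>p j\<close> is a
  price added to the cost of column \<open>j\<close>, so that both \<open>u\<close> and
  \<open>p\<close> are raised, never lowered, by a nonnegative shift.\<close>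

definition dual_feasible :: "(int \<Rightarrow> int) \<Rightarrow> (int \<Rightarrow> int) \<Rightarrow> bool" where
  "dual_feasible p u \<longleftrightarrow> (\<forall>i\<in>{0..<N}. \<forall>j\<in>{0..<N}. u i \<le> C i j + p j)"

text \<open>Rows below \<open>r\<close> are matched along tight edges to columns other than the hole \<open>h\<close>; \<open>m\<close> maps a
  row to its column and \<open>ow\<close> a column to its row plus one, or to 0 if it is free. The entry of
  \<open>ow\<close> at the hole is arbitrary, and there is no hole if \<open>h = - 1\<close>.\<close>

definition matched ::
    "int \<Rightarrow> int \<Rightarrow> (int \<Rightarrow> int) \<Rightarrow> (int \<Rightarrow> int) \<Rightarrow> (int \<Rightarrow> int) \<Rightarrow> (int \<Rightarrow> int) \<Rightarrow> bool" where
  "matched r h p u ow m \<longleftrightarrow>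
     (\<forall>i\<in>{0..<r}. m i \<in> {0..<N} \<and> m i \<noteq> h \<and> ow (m i) = i + 1 \<and> u i = C i (m i) + p (m i)) \<and>
     (\<forall>j\<in>{0..<N}. j \<noteq> h \<longrightarrow> ow j = 0 \<or> ow j - 1 \<in> {0..<r} \<and> m (ow j - 1) = j)"

text \<open>The value \<open>r + 1\<close> marks the rows (\<open>A\<close>) and columns (\<open>X\<close>) of the alternating tree of phase \<open>r\<close>;
  the marks of earlier phases are smaller and need not be cleared.\<close>

definition tree_cols :: "int \<Rightarrow> (int \<Rightarrow> int) \<Rightarrow> int set" where
  "tree_cols r X = {j\<in>{0..<N}. X j = r + 1}"

definition cands :: "int \<Rightarrow> (int \<Rightarrow> int) \<Rightarrow> (int \<Rightarrow> int) \<Rightarrow> (int \<times> int) set" where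
  "cands r X A = {(i, j). i \<in> {0..<N} \<and> j \<in> {0..<N} \<and> A i = r + 1 \<and> X j \<noteq> r + 1}"

text \<open>\<open>t j\<close> is the row from which the column \<open>j\<close> was reached, \<open>k j\<close> the time when it was.\<close>

definition tree_edge :: "int \<Rightarrow> (int \<Rightarrow> int) \<Rightarrow> (int \<Rightarrow> int) \<Rightarrow> (int \<Rightarrow> int) \<Rightarrow> (int \<Rightarrow> int) \<Rightarrow>
    (int \<Rightarrow> int) \<Rightarrow> (int \<Rightarrow> int) \<Rightarrow> int \<Rightarrow> bool" where
  "tree_edge r p u m X t k j \<longleftrightarrow>
     (t j = r \<or> t j \<in> {0..<r} \<and> X (m (t j)) = r + 1 \<and> k (m (t j)) < k j) \<and>
     u (t j) = C (t j) j + p j"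

text \<open>The alternating tree is rooted at the unmatched row \<open>r\<close> and contains the
  owners of its columns. All its columns are occupied, because reaching a free one ends the growth.
  Every growth step adds one column, so \<open>y\<close> is both the number of steps made and the
  number of tree columns.\<close>

definition tree :: "int \<Rightarrow> int \<Rightarrow> (int \<Rightarrow> int) \<Rightarrow> (int \<Rightarrow> int) \<Rightarrow> (int \<Rightarrow> int) \<Rightarrow> (int \<Rightarrow> int) \<Rightarrow>
    (int \<Rightarrow> int) \<Rightarrow> (int \<Rightarrow> int) \<Rightarrow> (int \<Rightarrow> int) \<Rightarrow> (int \<Rightarrow> int) \<Rightarrow> bool" where
  "tree r y p u ow m X A t k \<longleftrightarrow>
     A r = r + 1 \<and> (\<forall>i\<in>{0..<N}. A i = r + 1 \<longrightarrow> i \<le> r) \<and>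
     (\<forall>i\<in>{0..<r}. A i = r + 1 \<longleftrightarrow> X (m i) = r + 1) \<and>
     (\<forall>j\<in>tree_cols r X.
        ow j \<noteq> 0 \<and> A (t j) = r + 1 \<and> tree_edge r p u m X t k j \<and> 0 \<le> k j \<and> k j < y) \<and>
     int (card (tree_cols r X)) = y"

text \<open>The state while the alternating path is flipped from its free end back to the root; the
  hole \<open>g\<close> is the column that still waits for a row. Flipping may spoil tree edges of
  columns reached later than \<open>g\<close>, hence the restriction to
  \<open>k j \<le> k g\<close>.\<close>

definition augmenting :: "int \<Rightarrow> (int \<Rightarrow> int) \<Rightarrow> (int \<Rightarrow> int) \<Rightarrow> (int \<Rightarrow> int) \<Rightarrow> (int \<Rightarrow> int) \<Rightarrow>
    (int \<Rightarrow> int) \<Rightarrow> (int \<Rightarrow> int) \<Rightarrow> (int \<Rightarrow> int) \<Rightarrow> int \<Rightarrow> bool" where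
  "augmenting r p u ow m X t k g \<longleftrightarrow>
     matched r g p u ow m \<and> g \<in> tree_cols r X \<and>
     (\<forall>j\<in>tree_cols r X. 0 \<le> k j \<and> (k j \<le> k g \<longrightarrow> tree_edge r p u m X t k j))"

text \<open>Occupied columns are images of the rows below \<open>r\<close>, so there are at most
  \<open>r\<close> < \<open>N\<close> tree columns. Some column is therefore outside the tree, and
  the root together with it is a candidate. The bound on \<open>y\<close> is what makes the growth
  end.\<close>

lemma tree_cands:
  assumes r: "0 \<le> r" "r < N" and m: "matched r (- 1) p u ow m" and t: "tree r y p u ow m X A t k"
  shows "y \<le> r" "cands r X A \<noteq> {}"
proof -
  have sub: "tree_cols r X \<subseteq> m ` {0..<r}"
  proof
    fix j assume j: "j \<in> tree_cols r X"
    then have "ow j \<noteq> 0" "j \<in> {0..<N}" using t by (auto simp: tree_def tree_cols_def)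
    then have "ow j - 1 \<in> {0..<r}" "m (ow j - 1) = j" using m by (auto simp: matched_def)
    then show "j \<in> m ` {0..<r}" by (metis image_eqI)
  qed
  have "card (tree_cols r X) \<le> card (m ` {0..<r})" by (rule card_mono[OF _ sub]) simp
  also have "\<dots> \<le> nat r" using card_image_le[of "{0..<r}" m] by simp
  finally have c: "card (tree_cols r X) \<le> nat r" .
  then show "y \<le> r" using t r by (auto simp: tree_def)
  have "\<not> {0..<N} \<subseteq> tree_cols r X"
    using card_mono[of "tree_cols r X" "{0..<N}"] c r finite_subset[OF sub] by auto
  then obtain j where "j \<in> {0..<N}" "j \<notin> tree_cols r X" by blast
  then have "(r, j) \<in> cands r X A" using t r by (auto simp: tree_def cands_def tree_cols_def)
  then show "cands r X A \<noteq> {}" by blast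
qed

text \<open>Raising the potentials of all tree rows and tree columns by the least slack
  \<open>d\<close> leaves tree edges tight. Only candidate pairs lose slack, and none loses more
  than it has, while the minimising pair becomes tight. Its column is either free, which yields an
  augmenting path, or joins the tree with its owner.\<close>

lemma tree_step:
  assumes r: "0 \<le> r" "r < N" and y: "0 \<le> y" and du: "dual_feasible p u"
    and ma: "matched r (- 1) p u ow m" and tr: "tree r y p u ow m X A t k"
    and best: "best_pair (\<lambda>i j. C i j + p j - u i) (cands r X A) h d e g"
    and u': "\<And>i. u' i = u i + (if i \<in> {0..<N} \<and> A i = r + 1 then d else 0)"
    and p': "\<And>j. p' j = p j + (if j \<in> {0..<N} \<and> X j = r + 1 then d else 0)"
  shows "dual_feasible p' u'"
    and "ow g = 0 \<Longrightarrow> augmenting r p' u' ow m (X(g := r + 1)) (t(g := e)) (k(g := y)) g"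
    and "ow g \<noteq> 0 \<Longrightarrow> matched r (- 1) p' u' ow m \<and>
      tree r (y + 1) p' u' ow m (X(g := r + 1)) (A(ow g - 1 := r + 1)) (t(g := e)) (k(g := y))"
    and "g \<in> {0..<N}"
proof -
  have "cands r X A \<noteq> {}" using tree_cands[OF r ma tr] by simp
  then have eg: "(e, g) \<in> cands r X A" and d: "d = C e g + p g - u e"
    and least: "\<And>i j. (i, j) \<in> cands r X A \<Longrightarrow> d \<le> C i j + p j - u i"
    using best by (auto simp: best_pair_def)
  then have e: "e \<in> {0..<N}" "A e = r + 1" and g: "g \<in> {0..<N}" "X g \<noteq> r + 1"
    by (auto simp: cands_def)
  show "g \<in> {0..<N}" by (rule g)
  have "0 \<le> d" using du e g d by (auto simp: dual_feasible_def)
  show "dual_feasible p' u'"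
    unfolding dual_feasible_def
  proof (intro ballI)
    fix i j assume ij: "i \<in> {0..<N}" "j \<in> {0..<N}"
    then have "u i \<le> C i j + p j" using du by (auto simp: dual_feasible_def)
    moreover have "A i = r + 1 \<Longrightarrow> X j \<noteq> r + 1 \<Longrightarrow> d \<le> C i j + p j - u i"
      using ij by (intro least) (auto simp: cands_def)
    ultimately show "u' i \<le> C i j + p' j" using \<open>0 \<le> d\<close> ij by (auto simp: u' p')
  qed
  have col: "m i \<in> {0..<N}" if "i \<in> {0..<r}" for i using ma that by (auto simp: matched_def)
  have AX: "A i = r + 1 \<longleftrightarrow> X (m i) = r + 1" if "i \<in> {0..<r}" for i
    using tr that by (auto simp: tree_def)
  \<comment> \<open>Matched pairs stay tight: a row below \<open>r\<close> is in the tree exactly if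
    its column is, so both potentials move together or not at all.\<close>
  have ma': "matched r (- 1) p' u' ow m"
    using ma AX col r unfolding matched_def u' p' by auto
  have er: "e = r \<or> e \<in> {0..<r}" using e tr r by (force simp: tree_def)
  have old: "tree_edge r p' u' m (X(g := r + 1)) (t(g := e)) (k(g := y)) j"
    if "j \<in> tree_cols r X" for j
  proof -
    have *: "tree_edge r p u m X t k j" "A (t j) = r + 1" "j \<noteq> g" "j \<in> {0..<N}" "X j = r + 1"
      using that tr g by (auto simp: tree_def tree_cols_def)
    then have "t j \<in> {0..<N}" using r by (auto simp: tree_edge_def)
    with * show ?thesis using g by (auto simp: tree_edge_def u' p')
  qed
  have new: "tree_edge r p' u' m (X(g := r + 1)) (t(g := e)) (k(g := y)) g"
  proof -
    have "u' e = C e g + p' g" using e g d by (simp add: u' p')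
    moreover have "X (m e) = r + 1 \<and> k (m e) < y \<and> m e \<noteq> g" if "e \<in> {0..<r}"
    proof -
      have "X (m e) = r + 1" using AX that e by auto
      moreover from this have "m e \<in> tree_cols r X" using col that by (auto simp: tree_cols_def)
      ultimately show ?thesis using tr g by (auto simp: tree_def)
    qed
    ultimately show ?thesis using er by (auto simp: tree_edge_def)
  qed
  have cols: "tree_cols r (X(g := r + 1)) = insert g (tree_cols r X)"
    using g by (auto simp: tree_cols_def)
  have k: "0 \<le> k j \<and> k j < y" if "j \<in> tree_cols r X" for j using tr that by (auto simp: tree_def)
  show "augmenting r p' u' ow m (X(g := r + 1)) (t(g := e)) (k(g := y)) g" if "ow g = 0"
  proof -
    have "matched r g p' u' ow m" using ma' that by (force simp: matched_def)
    moreover have "g \<in> tree_cols r (X(g := r + 1))" by (simp add: cols)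
    ultimately show ?thesis
      unfolding augmenting_def using y k old new by (auto simp: cols)
  qed
  show "matched r (- 1) p' u' ow m \<and>
      tree r (y + 1) p' u' ow m (X(g := r + 1)) (A(ow g - 1 := r + 1)) (t(g := e)) (k(g := y))"
    if "ow g \<noteq> 0"
  proof
    let ?i = "ow g - 1"
    have i: "?i \<in> {0..<r}" "m ?i = g" using ma g that by (auto simp: matched_def)
    have inj: "m i = g \<longleftrightarrow> i = ?i" if "i \<in> {0..<r}" for i
      using ma that i by (auto simp: matched_def)
    have "g \<notin> tree_cols r X" using g by (auto simp: tree_cols_def)
    moreover have "finite (tree_cols r X)"
      by (rule finite_subset[of _ "{0..<N}"]) (auto simp: tree_cols_def)
    ultimately have "int (card (tree_cols r (X(g := r + 1)))) = y + 1"
      using tr by (simp add: cols tree_def)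
    moreover have "\<forall>i\<in>{0..<r}. (A(?i := r + 1)) i = r + 1 \<longleftrightarrow> (X(g := r + 1)) (m i) = r + 1"
      using AX inj by auto
    moreover have "(A(?i := r + 1)) r = r + 1"
      "\<forall>i\<in>{0..<N}. (A(?i := r + 1)) i = r + 1 \<longrightarrow> i \<le> r"
      using tr i by (auto simp: tree_def)
    moreover have "ow j \<noteq> 0 \<and> (A(?i := r + 1)) ((t(g := e)) j) = r + 1 \<and>
        tree_edge r p' u' m (X(g := r + 1)) (t(g := e)) (k(g := y)) j \<and>
        0 \<le> (k(g := y)) j \<and> (k(g := y)) j < y + 1"
      if "j \<in> tree_cols r (X(g := r + 1))" for j
    proof (cases "j = g")
      case True
      then show ?thesis using new \<open>ow g \<noteq> 0\<close> y e by simp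
    next
      case False
      then have "j \<in> tree_cols r X" using that cols by simp
      then show ?thesis using old[of j] k[of j] False tr by (auto simp: tree_def)
    qed
    ultimately show "tree r (y + 1) p' u' ow m (X(g := r + 1)) (A(?i := r + 1)) (t(g := e)) (k(g := y))"
      unfolding tree_def by blast
  qed (rule ma')
qed

text \<open>Row \<open>e\<close>, from which \<open>g\<close> was reached, takes over
  \<open>g\<close>. If \<open>e\<close> is the root, the path is finished; otherwise the former
  column of \<open>e\<close> becomes the hole. That column was reached earlier, so its time is a
  termination measure.\<close>

lemma augmenting_step:
  assumes r: "0 \<le> r" "r < N" and au: "augmenting r p u ow m X t k g" and e: "e = t g"
  defines "m' \<equiv> m(e := g)" and "ow' \<equiv> ow(g := e + 1)"
  shows "e = r \<Longrightarrow> matched (r + 1) (- 1) p u ow' m'"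
    and "e \<noteq> r \<Longrightarrow> augmenting r p u ow' m' X t k (m e) \<and> k (m e) < k g"
proof -
  have ma: "matched r g p u ow m" and g: "g \<in> {0..<N}" "X g = r + 1"
    using au by (auto simp: augmenting_def tree_cols_def)
  have te: "tree_edge r p u m X t k g" using au by (auto simp: augmenting_def)
  have tight: "u e = C e g + p g" using te by (auto simp: tree_edge_def e)
  have row: "m i \<in> {0..<N}" "m i \<noteq> g" "ow (m i) = i + 1" "u i = C i (m i) + p (m i)"
    if "i \<in> {0..<r}" for i
    using ma that by (auto simp: matched_def)
  have colm: "ow j = 0 \<or> ow j - 1 \<in> {0..<r} \<and> m (ow j - 1) = j" if "j \<in> {0..<N}" "j \<noteq> g" for j
    using ma that by (auto simp: matched_def)
  show "matched (r + 1) (- 1) p u ow' m'" if "e = r"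
    unfolding matched_def
  proof (intro conjI ballI impI)
    fix i assume i: "i \<in> {0..<r + 1}"
    show "m' i \<in> {0..<N}" "m' i \<noteq> - 1" "ow' (m' i) = i + 1" "u i = C i (m' i) + p (m' i)"
      using row[of i] i g tight that by (cases "i = r"; auto simp: m'_def ow'_def)+
  next
    fix j assume "j \<in> {0..<N}"
    then show "ow' j = 0 \<or> ow' j - 1 \<in> {0..<r + 1} \<and> m' (ow' j - 1) = j"
      using colm[of j] that r by (cases "j = g") (auto simp: m'_def ow'_def)
  qed
  show "augmenting r p u ow' m' X t k (m e) \<and> k (m e) < k g" if "e \<noteq> r"
  proof
    have er: "e \<in> {0..<r}" "X (m e) = r + 1" and less: "k (m e) < k g"
      using te that by (auto simp: tree_edge_def e)
    show "k (m e) < k g" by (rule less)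
    have ne: "m i \<noteq> m e" if "i \<in> {0..<r}" "i \<noteq> e" for i
      using row(3)[of i] row(3)[of e] that er by auto
    have "matched r (m e) p u ow' m'"
      unfolding matched_def
    proof (intro conjI ballI impI)
      fix i assume i: "i \<in> {0..<r}"
      show "m' i \<in> {0..<N}" "m' i \<noteq> m e" "ow' (m' i) = i + 1" "u i = C i (m' i) + p (m' i)"
        using row[of i] row[of e] er ne[of i] i g tight
        by (cases "i = e"; simp add: m'_def ow'_def)+
    next
      fix j assume "j \<in> {0..<N}" "j \<noteq> m e"
      then show "ow' j = 0 \<or> ow' j - 1 \<in> {0..<r} \<and> m' (ow' j - 1) = j"
        using colm[of j] er by (cases "j = g") (auto simp: m'_def ow'_def)
    qed
    moreover have "m e \<in> tree_cols r X" using row(1)[of e] er by (auto simp: tree_cols_def)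
    moreover have "0 \<le> k j \<and> (k j \<le> k (m e) \<longrightarrow> tree_edge r p u m' X t k j)"
      if j: "j \<in> tree_cols r X" for j
    proof (intro conjI impI)
      show "0 \<le> k j" using au j by (auto simp: augmenting_def)
      assume le: "k j \<le> k (m e)"
      then have "tree_edge r p u m X t k j" using au j less by (auto simp: augmenting_def)
      \<comment> \<open>Only the entry of \<open>m\<close> at \<open>e\<close> has changed, and an
        edge leaving \<open>e\<close> would force \<open>k (m e) < k j\<close>.\<close>
      moreover from this have "t j \<noteq> e" using le that \<open>e \<noteq> r\<close> by (auto simp: tree_edge_def)
      ultimately show "tree_edge r p u m' X t k j" by (auto simp: tree_edge_def m'_def)
    qed
    ultimately show "augmenting r p u ow' m' X t k (m e)" by (auto simp: augmenting_def)
  qed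
qed

text \<open>Weak duality: tight edges turn the cost of \<open>m\<close> into the sum of
  \<open>u\<close> minus the sum of \<open>p\<close>, which is a lower bound for every permutation,
  since all permutations collect the same total of \<open>p\<close>.\<close>

lemma matched_optimal:
  assumes "dual_feasible p u" "matched N (- 1) p u ow m" "bij_betw f {0..<N} {0..<N}"
  shows "bij_betw m {0..<N} {0..<N}" "(\<Sum>i\<in>{0..<N}. C i (m i)) \<le> (\<Sum>i\<in>{0..<N}. C i (f i))"
proof -
  have "inj_on m {0..<N}"
  proof (rule inj_onI)
    fix i i' assume a: "i \<in> {0..<N}" "i' \<in> {0..<N}" "m i = m i'"
    then have "ow (m i) = i + 1" "ow (m i') = i' + 1"
      using assms(2) unfolding matched_def by blast+
    with a(3) show "i = i'" by (metis add_right_cancel)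
  qed
  moreover have "m ` {0..<N} \<subseteq> {0..<N}" using assms(2) by (auto simp: matched_def)
  ultimately show m: "bij_betw m {0..<N} {0..<N}"
    unfolding bij_betw_def using endo_inj_surj[of "{0..<N}" m] by auto
  have "(\<Sum>i\<in>{0..<N}. C i (m i)) + (\<Sum>i\<in>{0..<N}. p (m i)) = (\<Sum>i\<in>{0..<N}. u i)"
    unfolding sum.distrib[symmetric] using assms(2) by (intro sum.cong) (auto simp: matched_def)
  also have "\<dots> \<le> (\<Sum>i\<in>{0..<N}. C i (f i) + p (f i))"
    using assms(1) bij_betwE[OF assms(3)] by (intro sum_mono) (auto simp: dual_feasible_def)
  also have "\<dots> = (\<Sum>i\<in>{0..<N}. C i (f i)) + (\<Sum>i\<in>{0..<N}. p (f i))" by (rule sum.distrib)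
  finally show "(\<Sum>i\<in>{0..<N}. C i (m i)) \<le> (\<Sum>i\<in>{0..<N}. C i (f i))"
    using sum.reindex_bij_betw[OF m, of p] sum.reindex_bij_betw[OF assms(3), of p] by simp
qed

end

section \<open>The Hungarian method as a loop program\<close>

abbreviation stamp :: aexp where
  "stamp \<equiv> Add (scalar ''r'') (Lit 1)"

definition relax :: "aexp \<Rightarrow> prog" where
  "relax ce =
     Branch (Neg (Eq (Cell ''X'' (scalar ''j'')) stamp))
       (Block
          (assign ''c'' (Sub (Add ce (Cell ''p'' (scalar ''j''))) (Cell ''u'' (scalar ''i''))))
          (Branch (Or (Eq (scalar ''h'') (Lit 0)) (Less (scalar ''c'') (scalar ''d'')))
             (Block (assign ''d'' (scalar ''c'')) (Block (assign ''e'' (scalar ''i''))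
                (Block (assign ''g'' (scalar ''j'')) (assign ''h'' (Lit 1)))))
             Nop))
       Nop"

definition scan :: "aexp \<Rightarrow> prog" where
  "scan ce =
     For_upto ''i'' ''N''
       (Branch (Eq (Cell ''A'' (scalar ''i'')) stamp) (For_upto ''j'' ''N'' (relax ce)) Nop)"

definition shift_duals :: prog where
  "shift_duals =
     For_upto ''i'' ''N''
       (Block
          (Branch (Eq (Cell ''A'' (scalar ''i'')) stamp)
             (Assign ''u'' (scalar ''i'') (Add (Cell ''u'' (scalar ''i'')) (scalar ''d''))) Nop)
          (Branch (Eq (Cell ''X'' (scalar ''i'')) stamp)
             (Assign ''p'' (scalar ''i'') (Add (Cell ''p'' (scalar ''i'')) (scalar ''d''))) Nop))"

definition grow_tail :: prog where
  "grow_tail =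
     Block (Assign ''X'' (scalar ''g'') stamp)
       (Block (Assign ''t'' (scalar ''g'') (scalar ''e''))
       (Block (Assign ''k'' (scalar ''g'') (scalar ''y''))
          (Branch (Eq (Cell ''o'' (scalar ''g'')) (Lit 0))
             (assign ''f'' (Lit 1))
             (Assign ''A'' (Sub (Cell ''o'' (scalar ''g'')) (Lit 1)) stamp))))"

definition grow :: "aexp \<Rightarrow> prog" where
  "grow ce =
     Branch (Eq (scalar ''f'') (Lit 0))
       (Block (assign ''h'' (Lit 0)) (Block (scan ce) (Block shift_duals grow_tail)))
       Nop"

definition augment :: prog where
  "augment =
     Branch (Eq (scalar ''f'') (Lit 1))
       (Block (assign ''e'' (Cell ''t'' (scalar ''g'')))
       (Block (assign ''v'' (Cell ''m'' (scalar ''e'')))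
       (Block (Assign ''o'' (scalar ''g'') (Add (scalar ''e'') (Lit 1)))
       (Block (Assign ''m'' (scalar ''e'') (scalar ''g''))
          (Branch (Eq (scalar ''e'') (scalar ''r''))
             (assign ''f'' (Lit 2))
             (assign ''g'' (scalar ''v'')))))))
       Nop"

text \<open>The flag \<open>f\<close> is 0 while the tree grows, 1 once a free column has been
  reached and 2 after the path has been flipped; a step whose flag does not fit does nothing. During
  growth the counter \<open>y\<close> doubles as the time stamp stored in \<open>k\<close>.\<close>

definition phase :: "aexp \<Rightarrow> prog" where
  "phase ce =
     Block (Assign ''A'' (scalar ''r'') stamp)
       (Block (assign ''f'' (Lit 0)) (Block (For ''y'' (grow ce)) (For ''y'' augment)))"

definition hungarian :: "aexp \<Rightarrow> prog" where
  "hungarian ce = For_upto ''r'' ''N'' (phase ce)"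

definition work_vars :: "vname set" where
  "work_vars = {''p'', ''u'', ''o'', ''m'', ''X'', ''A'', ''t'', ''k'', ''r'', ''y'', ''i'', ''j'',
     ''h'', ''d'', ''e'', ''g'', ''f'', ''c'', ''v''}"

lemma writes_relax [simp]: "writes (relax ce) = {''c'', ''d'', ''e'', ''g'', ''h''}"
  by (auto simp: relax_def)

lemma writes_scan [simp]:
  "writes (scan ce) = {''i'', ''j'', ''c'', ''d'', ''e'', ''g'', ''h''}"
  by (auto simp: scan_def)

lemma writes_shift_duals [simp]: "writes shift_duals = {''i'', ''u'', ''p''}"
  by (auto simp: shift_duals_def)

lemma writes_grow_tail [simp]: "writes grow_tail = {''X'', ''t'', ''k'', ''f'', ''A''}"
  by (auto simp: grow_tail_def)

lemma writes_grow [simp]: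
  "writes (grow ce) = {''i'', ''j'', ''c'', ''d'', ''e'', ''g'', ''h'', ''u'', ''p'', ''X'', ''t'',
     ''k'', ''f'', ''A''}"
  by (auto simp: grow_def)

lemma writes_augment [simp]: "writes augment = {''e'', ''v'', ''o'', ''m'', ''f'', ''g''}"
  by (auto simp: augment_def)

lemma writes_phase [simp]:
  "writes (phase ce) = {''i'', ''j'', ''c'', ''d'', ''e'', ''g'', ''h'', ''u'', ''p'', ''X'', ''t'',
     ''k'', ''f'', ''A'', ''v'', ''o'', ''m'', ''y''}"
  by (auto simp: phase_def)

lemma writes_hungarian [simp]: "writes (hungarian ce) = work_vars"
  by (auto simp: hungarian_def work_vars_def)

lemma wf_hungarian [simp]: "wf_prog (hungarian ce) \<longleftrightarrow> safe ce"
  by (simp add: hungarian_def phase_def grow_def augment_def scan_def shift_duals_def grow_tail_def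
      relax_def)

section \<open>Correctness of the Hungarian program for an arbitrary cost expression\<close>

locale hungarian_run = assignment N C for N C +
  fixes ce :: aexp and Z :: "vname set" and s0 :: state
  assumes Z: "''in'' \<in> Z" "''N'' \<in> Z" "Z \<inter> work_vars = {}"
    and N_bound: "s0 ''N'' 0 = N" "N \<le> s0 ''in'' 0"
    and cost_eval: "\<And>s. \<lbrakk>\<And>z. z \<in> Z \<Longrightarrow> s z = s0 z; 0 \<le> s ''i'' 0; s ''i'' 0 < N;
      0 \<le> s ''j'' 0; s ''j'' 0 < N\<rbrakk> \<Longrightarrow> aval ce s = C (s ''i'' 0) (s ''j'' 0)"
begin

definition fixed :: "state \<Rightarrow> bool" where
  "fixed s \<longleftrightarrow> (\<forall>z\<in>Z. s z = s0 z)"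

lemma fixed_N: "fixed s \<Longrightarrow> s ''N'' 0 = N" "fixed s \<Longrightarrow> N \<le> s ''in'' 0"
    "fixed s \<Longrightarrow> 0 \<le> s ''in'' 0"
  using Z N_bound N_nonneg by (auto simp: fixed_def)

lemma fixed_frame: "fixed s \<Longrightarrow> (\<And>z. z \<notin> work_vars \<Longrightarrow> r z = s z) \<Longrightarrow> fixed r"
  using Z by (force simp: fixed_def)

lemma fixed_sem: "fixed s \<Longrightarrow> writes c \<subseteq> work_vars \<Longrightarrow> fixed (sem c s)"
  by (erule fixed_frame) (auto intro!: sem_frame)

abbreviation slack :: "(int \<Rightarrow> int) \<Rightarrow> (int \<Rightarrow> int) \<Rightarrow> int \<Rightarrow> int \<Rightarrow> int" where
  "slack p u \<equiv> \<lambda>i j. C i j + p j - u i"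

abbreviation best_in :: "(int \<Rightarrow> int \<Rightarrow> int) \<Rightarrow> (int \<times> int) set \<Rightarrow> state \<Rightarrow> bool" where
  "best_in w S s \<equiv> best_pair w S (s ''h'' 0) (s ''d'' 0) (s ''e'' 0) (s ''g'' 0)"

lemma relax_best:
  assumes "fixed s" "s ''i'' 0 = i" "s ''j'' 0 = j" "0 \<le> i" "i < N" "0 \<le> j" "j < N"
    and best: "best_in (slack (s ''p'') (s ''u'')) S s"
  shows "best_in (slack (s ''p'') (s ''u''))
    (if s ''X'' j \<noteq> s ''r'' 0 + 1 then insert (i, j) S else S) (sem (relax ce) s)"
proof -
  have "aval ce s = C i j" using cost_eval[of s] assms by (auto simp: fixed_def)
  then show ?thesis using assms best_pair_insert[OF best, of i j]
    by (simp add: relax_def)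
qed

text \<open>The candidates that precede (i, j) in lexicographic order, which is the order of the
  nested loops.\<close>

definition scanned :: "state \<Rightarrow> int \<Rightarrow> int \<Rightarrow> (int \<times> int) set" where
  "scanned s i j = {(a, b) \<in> cands (s ''r'' 0) (s ''X'') (s ''A''). a < i \<or> a = i \<and> b < j}"

lemma scan_best:
  assumes s: "fixed s" "s ''h'' 0 = 0"
  shows "best_in (slack (s ''p'') (s ''u'')) (cands (s ''r'' 0) (s ''X'') (s ''A''))
    (sem (scan ce) s)"
proof -
  let ?w = "slack (s ''p'') (s ''u'')"
  let ?I = "\<lambda>i. best_in ?w (scanned s i 0)"
  have "?I (s ''N'' 0) (sem (scan ce) s)"
    unfolding scan_def
  proof (rule For_upto_rule[where I = ?I])
    show "0 \<le> s ''N'' 0" "s ''N'' 0 \<le> s ''in'' 0"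
      using fixed_N[OF s(1)] N_nonneg by auto
    show "?I 0 s" using s by (auto simp: best_pair_def scanned_def cands_def)
  next
    fix i r
    assume i: "0 \<le> i" "i < s ''N'' 0" and I: "?I i r" and ri: "r ''i'' 0 = i"
      and fr: "\<And>z. z \<notin> insert ''i'' (writes (Branch (Eq (Cell ''A'' (scalar ''i'')) stamp)
        (For_upto ''j'' ''N'' (relax ce)) Nop)) \<Longrightarrow> r z = s z"
    have r: "r ''p'' = s ''p''" "r ''u'' = s ''u''" "r ''X'' = s ''X''" "r ''A'' = s ''A''"
      "r ''r'' = s ''r''" "r ''N'' = s ''N''" "r ''in'' = s ''in''"
      by (rule fr; simp)+
    have fx: "fixed r" by (rule fixed_frame[OF s(1)], rule fr) (auto simp: work_vars_def)
    show "?I (i + 1) (sem (Branch (Eq (Cell ''A'' (scalar ''i'')) stamp)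
        (For_upto ''j'' ''N'' (relax ce)) Nop) r)"
    proof (cases "s ''A'' i = s ''r'' 0 + 1")
      case False
      then have "scanned s (i + 1) 0 = scanned s i 0"
        by (auto simp: scanned_def cands_def zless_add1_eq)
      then show ?thesis using False I r ri by simp
    next
      case True
      let ?J = "\<lambda>j. best_in ?w (scanned s i j)"
      have "?J (r ''N'' 0) (sem (For_upto ''j'' ''N'' (relax ce)) r)"
      proof (rule For_upto_rule[where I = ?J])
        show "0 \<le> r ''N'' 0" "r ''N'' 0 \<le> r ''in'' 0"
          using fixed_N[OF fx] N_nonneg by auto
        show "?J 0 r" by (rule I)
      next
        fix j q
        assume j: "0 \<le> j" "j < r ''N'' 0" and J: "?J j q" and qj: "q ''j'' 0 = j"
          and fq: "\<And>z. z \<notin> insert ''j'' (writes (relax ce)) \<Longrightarrow> q z = r z"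
        have q: "q ''p'' = s ''p''" "q ''u'' = s ''u''" "q ''X'' = s ''X''"
          "q ''r'' = s ''r''" "q ''i'' = r ''i''"
          by (rule trans[OF fq r(1)] trans[OF fq r(2)] trans[OF fq r(3)] trans[OF fq r(5)] fq; simp)+
        have fxq: "fixed q" by (rule fixed_frame[OF fx], rule fq) (auto simp: work_vars_def)
        have ij: "i < N" "j < N" using i j r fixed_N[OF s(1)] by auto
        have "scanned s i (j + 1) =
            (if s ''X'' j \<noteq> s ''r'' 0 + 1 then insert (i, j) (scanned s i j) else scanned s i j)"
          using True i j ij by (auto simp: scanned_def cands_def) (metis order_le_less)
        then show "?J (j + 1) (sem (relax ce) q)"
          using relax_best[OF fxq, of i j "scanned s i j"] J q qj ri i j ij by simp
      qed auto
      moreover have "scanned s i (r ''N'' 0) = scanned s (i + 1) 0"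
        using fixed_N[OF fx] by (auto simp: scanned_def cands_def)
      ultimately show ?thesis using True r ri by simp
    qed
  qed auto
  moreover have "scanned s (s ''N'' 0) 0 = cands (s ''r'' 0) (s ''X'') (s ''A'')"
    using fixed_N[OF s(1)] by (auto simp: scanned_def cands_def)
  ultimately show ?thesis by simp
qed

lemma shift_duals_effect:
  assumes s: "fixed s"
  shows "sem shift_duals s ''u'' i =
      s ''u'' i + (if i \<in> {0..<N} \<and> s ''A'' i = s ''r'' 0 + 1 then s ''d'' 0 else 0)"
    and "sem shift_duals s ''p'' i =
      s ''p'' i + (if i \<in> {0..<N} \<and> s ''X'' i = s ''r'' 0 + 1 then s ''d'' 0 else 0)"
proof -
  let ?I = "\<lambda>n r. \<forall>i.
    r ''u'' i = s ''u'' i + (if i \<in> {0..<n} \<and> s ''A'' i = s ''r'' 0 + 1 then s ''d'' 0 else 0) \<and>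
    r ''p'' i = s ''p'' i + (if i \<in> {0..<n} \<and> s ''X'' i = s ''r'' 0 + 1 then s ''d'' 0 else 0)"
  let ?body = "Block
      (Branch (Eq (Cell ''A'' (scalar ''i'')) stamp)
         (Assign ''u'' (scalar ''i'') (Add (Cell ''u'' (scalar ''i'')) (scalar ''d''))) Nop)
      (Branch (Eq (Cell ''X'' (scalar ''i'')) stamp)
         (Assign ''p'' (scalar ''i'') (Add (Cell ''p'' (scalar ''i'')) (scalar ''d''))) Nop)"
  have "?I (s ''N'' 0) (sem shift_duals s)"
    unfolding shift_duals_def
  proof (rule For_upto_rule[where I = ?I], goal_cases)
    case (9 n r)
    have r: "r ''A'' = s ''A''" "r ''X'' = s ''X''" "r ''r'' = s ''r''" "r ''d'' = s ''d''"
      by (rule 9(5); simp)+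
    show ?case
    proof
      fix i
      have "i \<in> {0..<n + 1} \<longleftrightarrow> i \<in> {0..<n} \<or> i = n" using 9(1) by auto
      then show "sem ?body r ''u'' i =
          s ''u'' i + (if i \<in> {0..<n + 1} \<and> s ''A'' i = s ''r'' 0 + 1 then s ''d'' 0 else 0) \<and>
        sem ?body r ''p'' i =
          s ''p'' i + (if i \<in> {0..<n + 1} \<and> s ''X'' i = s ''r'' 0 + 1 then s ''d'' 0 else 0)"
        using 9(3)[rule_format, of i] 9(4) r by (cases "i = n") simp_all
    qed
  qed (use fixed_N[OF s] N_nonneg in auto)
  then show "sem shift_duals s ''u'' i =
      s ''u'' i + (if i \<in> {0..<N} \<and> s ''A'' i = s ''r'' 0 + 1 then s ''d'' 0 else 0)"
    "sem shift_duals s ''p'' i =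
      s ''p'' i + (if i \<in> {0..<N} \<and> s ''X'' i = s ''r'' 0 + 1 then s ''d'' 0 else 0)"
    using fixed_N[OF s] by auto
qed

definition stamped :: "int \<Rightarrow> state \<Rightarrow> bool" where
  "stamped r s \<longleftrightarrow> (\<forall>i. s ''X'' i \<le> r \<and> s ''A'' i \<le> r)"

text \<open>After a free column has been found, only \<open>k g < y\<close> is kept of the counter.
  It bounds the length of the path back to the root and so the number of augmenting steps.\<close>

definition growing :: "int \<Rightarrow> int \<Rightarrow> state \<Rightarrow> bool" where
  "growing r y s \<longleftrightarrow> fixed s \<and> s ''r'' 0 = r \<and> stamped (r + 1) s \<and>
     dual_feasible (s ''p'') (s ''u'') \<and>
     (s ''f'' 0 = 0 \<and> matched r (- 1) (s ''p'') (s ''u'') (s ''o'') (s ''m'') \<and>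
        tree r y (s ''p'') (s ''u'') (s ''o'') (s ''m'') (s ''X'') (s ''A'') (s ''t'') (s ''k'') \<or>
      s ''f'' 0 = 1 \<and> s ''k'' (s ''g'' 0) < y \<and>
        augmenting r (s ''p'') (s ''u'') (s ''o'') (s ''m'') (s ''X'') (s ''t'') (s ''k'') (s ''g'' 0))"

text \<open>The time of the hole drops by at least one per step, so \<open>k g + y\<close> does not
  increase. When \<open>y\<close> reaches the iteration count, the first alternative would make the
  time negative, which \<open>augmenting\<close> excludes.\<close>

definition shrinking :: "int \<Rightarrow> int \<Rightarrow> state \<Rightarrow> bool" where
  "shrinking r y s \<longleftrightarrow> fixed s \<and> s ''r'' 0 = r \<and> stamped (r + 1) s \<and>
     dual_feasible (s ''p'') (s ''u'') \<and>
     (s ''f'' 0 = 1 \<and> s ''k'' (s ''g'' 0) + y < s0 ''in'' 0 \<and>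
        augmenting r (s ''p'') (s ''u'') (s ''o'') (s ''m'') (s ''X'') (s ''t'') (s ''k'') (s ''g'' 0) \<or>
      s ''f'' 0 = 2 \<and> matched (r + 1) (- 1) (s ''p'') (s ''u'') (s ''o'') (s ''m''))"

lemma growing_step:
  assumes r: "0 \<le> r" "r < N" and y: "0 \<le> y" "s ''y'' 0 = y" and s: "growing r y s"
  shows "growing r (y + 1) (sem (grow ce) s)"
proof (cases "s ''f'' 0 = 0")
  case False
  then show ?thesis using s by (auto simp: growing_def grow_def)
next
  case True
  let ?a = "s(''h'' := (s ''h'')(0 := 0))"
  define b where "b = sem (scan ce) ?a"
  define c where "c = sem shift_duals b"
  have step: "sem (grow ce) s = sem grow_tail c" using True by (simp add: grow_def b_def c_def)
  have s': "fixed s" "s ''r'' 0 = r" "stamped (r + 1) s" "dual_feasible (s ''p'') (s ''u'')"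
    "matched r (- 1) (s ''p'') (s ''u'') (s ''o'') (s ''m'')"
    "tree r y (s ''p'') (s ''u'') (s ''o'') (s ''m'') (s ''X'') (s ''A'') (s ''t'') (s ''k'')"
    using s True by (auto simp: growing_def)
  have fa: "fixed ?a" by (rule fixed_frame[OF s'(1)]) (auto simp: work_vars_def)
  have fb: "fixed b" unfolding b_def by (rule fixed_sem[OF fa]) (auto simp: work_vars_def)
  have fc: "fixed c" unfolding c_def by (rule fixed_sem[OF fb]) (auto simp: work_vars_def)
  have b: "b ''p'' = s ''p''" "b ''u'' = s ''u''" "b ''o'' = s ''o''" "b ''m'' = s ''m''"
    "b ''X'' = s ''X''" "b ''A'' = s ''A''" "b ''t'' = s ''t''" "b ''k'' = s ''k''"
    "b ''r'' = s ''r''" "b ''y'' = s ''y''" "b ''f'' = s ''f''"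
    by (simp_all add: b_def sem_frame)
  have c: "c ''o'' = s ''o''" "c ''m'' = s ''m''" "c ''X'' = s ''X''" "c ''A'' = s ''A''"
    "c ''t'' = s ''t''" "c ''k'' = s ''k''" "c ''r'' = s ''r''" "c ''y'' = s ''y''"
    "c ''f'' = s ''f''" "c ''h'' = b ''h''" "c ''d'' = b ''d''" "c ''e'' = b ''e''" "c ''g'' = b ''g''"
    by (simp_all add: c_def sem_frame b)
  have best: "best_in (slack (s ''p'') (s ''u'')) (cands r (s ''X'') (s ''A'')) b"
    using scan_best[OF fa] s'(2) by (simp add: b_def)
  note T = tree_step[OF r y(1) s'(4,5,6) best, where u' = "c ''u''" and p' = "c ''p''"]
  have u': "c ''u'' i = s ''u'' i + (if i \<in> {0..<N} \<and> s ''A'' i = r + 1 then b ''d'' 0 else 0)"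
    and p': "c ''p'' i = s ''p'' i + (if i \<in> {0..<N} \<and> s ''X'' i = r + 1 then b ''d'' 0 else 0)" for i
    using shift_duals_effect[OF fb, of i] s'(2) by (simp_all add: c_def b)
  note T = T[OF u' p']
  have "fixed (sem grow_tail c)" by (rule fixed_sem[OF fc]) (auto simp: work_vars_def)
  moreover have "stamped (r + 1) (sem grow_tail c)"
    using s'(2,3) by (auto simp: stamped_def grow_tail_def c)
  moreover have "sem grow_tail c ''r'' 0 = r" using s'(2) by (simp add: sem_frame c)
  moreover have "sem grow_tail c ''p'' = c ''p''" "sem grow_tail c ''u'' = c ''u''"
    by (simp_all add: sem_frame)
  moreover have "sem grow_tail c ''f'' 0 = 1 \<and>
      sem grow_tail c ''k'' (sem grow_tail c ''g'' 0) < y + 1 \<and>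
      augmenting r (c ''p'') (c ''u'') (sem grow_tail c ''o'') (sem grow_tail c ''m'')
        (sem grow_tail c ''X'') (sem grow_tail c ''t'') (sem grow_tail c ''k'') (sem grow_tail c ''g'' 0)"
    if "s ''o'' (b ''g'' 0) = 0"
    using T(2)[OF that] that y s'(2) by (simp add: grow_tail_def c)
  moreover have "sem grow_tail c ''f'' 0 = 0 \<and>
      matched r (- 1) (c ''p'') (c ''u'') (sem grow_tail c ''o'') (sem grow_tail c ''m'') \<and>
      tree r (y + 1) (c ''p'') (c ''u'') (sem grow_tail c ''o'') (sem grow_tail c ''m'')
        (sem grow_tail c ''X'') (sem grow_tail c ''A'') (sem grow_tail c ''t'') (sem grow_tail c ''k'')"
    if "s ''o'' (b ''g'' 0) \<noteq> 0"
    using T(3)[OF that] that y s'(2) True by (simp add: grow_tail_def c)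
  ultimately show ?thesis using T(1) unfolding growing_def step by auto
qed

lemma shrinking_step:
  assumes r: "0 \<le> r" "r < N" and s: "shrinking r y s"
  shows "shrinking r (y + 1) (sem augment s)"
proof (cases "s ''f'' 0 = 1")
  case False
  then show ?thesis using s by (auto simp: shrinking_def augment_def)
next
  case True
  have s': "fixed s" "s ''r'' 0 = r" "stamped (r + 1) s" "dual_feasible (s ''p'') (s ''u'')"
    "s ''k'' (s ''g'' 0) + y < s0 ''in'' 0"
    "augmenting r (s ''p'') (s ''u'') (s ''o'') (s ''m'') (s ''X'') (s ''t'') (s ''k'') (s ''g'' 0)"
    using s True by (auto simp: shrinking_def)
  note T = augmenting_step[OF r s'(6) refl]
  have "fixed (sem augment s)" by (rule fixed_sem[OF s'(1)]) (auto simp: work_vars_def)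
  moreover have "stamped (r + 1) (sem augment s)"
    using s'(3) by (simp add: stamped_def sem_frame)
  moreover have "sem augment s ''r'' 0 = r" "sem augment s ''p'' = s ''p''" "sem augment s ''u'' = s ''u''"
    using s'(2) by (simp_all add: sem_frame)
  ultimately show ?thesis
    using s'(2,4,5) T True by (auto simp: shrinking_def augment_def)
qed

definition solved :: "int \<Rightarrow> state \<Rightarrow> bool" where
  "solved r s \<longleftrightarrow> fixed s \<and> stamped r s \<and> dual_feasible (s ''p'') (s ''u'') \<and>
     matched r (- 1) (s ''p'') (s ''u'') (s ''o'') (s ''m'')"

lemma solved_step:
  assumes r: "0 \<le> r" "r < N" "s ''r'' 0 = r" and s: "solved r s"
  shows "solved (r + 1) (sem (phase ce) s)"
proof -
  define a where "a = sem (Block (Assign ''A'' (scalar ''r'') stamp) (assign ''f'' (Lit 0))) s"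
  define b where "b = sem (For ''y'' (grow ce)) a"
  have step: "sem (phase ce) s = sem (For ''y'' augment) b"
    by (simp add: phase_def a_def b_def)
  have fa: "fixed a" using s unfolding a_def solved_def by (intro fixed_sem) (auto simp: work_vars_def)
  have a: "a ''A'' = (s ''A'')(r := r + 1)" "a ''f'' 0 = 0"
    "\<And>z. z \<noteq> ''A'' \<Longrightarrow> z \<noteq> ''f'' \<Longrightarrow> a z = s z"
    using r(3) by (simp_all add: a_def)
  have X: "s ''X'' i \<noteq> r + 1" "s ''A'' i \<noteq> r + 1" for i
    using s unfolding solved_def stamped_def by (metis add_le_same_cancel1 not_one_le_zero)+
  have "tree_cols r (s ''X'') = {}" using X by (auto simp: tree_cols_def)
  then have "tree r 0 (s ''p'') (s ''u'') (s ''o'') (s ''m'') (s ''X'') ((s ''A'')(r := r + 1))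
      (s ''t'') (s ''k'')"
    using X by (auto simp: tree_def)
  moreover have "stamped (r + 1) a" using s a(1,3) unfolding solved_def stamped_def
    by (simp add: add_increasing2)
  ultimately have 0: "growing r 0 a" using s a fa r(3) by (auto simp: growing_def solved_def)
  have "growing r (a ''in'' 0) b"
    unfolding b_def
  proof (rule For_rule[where I = "growing r"])
    show "0 \<le> a ''in'' 0" by (rule fixed_N[OF fa])
    show "growing r y (q(''y'' := v))" if "growing r y q" for y q v
      using that fixed_frame[of q "q(''y'' := v)"]
      by (auto simp: growing_def stamped_def work_vars_def)
    show "growing r (y + 1) (sem (grow ce) q)" if "0 \<le> y" "growing r y q" "q ''y'' 0 = y" for y q
      using growing_step[OF r(1,2) that(1,3,2)] .
  qed (use 0 in auto)
  moreover have in0: "a ''in'' 0 = s0 ''in'' 0" using fa Z by (auto simp: fixed_def)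
  moreover have "N \<le> s0 ''in'' 0" by (rule N_bound)
  \<comment> \<open>The flag cannot still be 0: the tree would have at least \<open>N\<close>
    columns, against the bound \<open>r\<close> of \<open>tree_cands\<close>.\<close>
  ultimately have b: "shrinking r 0 b"
    using tree_cands(1)[OF r(1,2)] r by (fastforce simp: growing_def shrinking_def)
  then have fb: "fixed b" by (simp add: shrinking_def)
  have "shrinking r (b ''in'' 0) (sem (For ''y'' augment) b)"
  proof (rule For_rule[where I = "shrinking r"])
    show "0 \<le> b ''in'' 0" by (rule fixed_N[OF fb])
    show "shrinking r y (q(''y'' := v))" if "shrinking r y q" for y q v
      using that fixed_frame[of q "q(''y'' := v)"]
      by (auto simp: shrinking_def stamped_def work_vars_def)
    show "shrinking r (y + 1) (sem augment q)" if "shrinking r y q" for y q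
      using shrinking_step[OF r(1,2) that] .
  qed (use b in auto)
  moreover have "b ''in'' 0 = s0 ''in'' 0" using fb Z by (auto simp: fixed_def)
  ultimately show ?thesis unfolding step
    by (auto simp: shrinking_def solved_def augmenting_def)
qed

lemma hungarian_solved:
  assumes s: "fixed s" "\<And>z i. z \<in> work_vars \<Longrightarrow> s z i = 0"
  shows "solved N (sem (hungarian ce) s)"
proof -
  have "solved (s ''N'' 0) (sem (hungarian ce) s)"
    unfolding hungarian_def
  proof (rule For_upto_rule[where I = solved])
    show "0 \<le> s ''N'' 0" "s ''N'' 0 \<le> s ''in'' 0" using fixed_N[OF s(1)] N_nonneg by auto
    show "solved r (q(''r'' := v))" if "solved r q" for r q v
      using that fixed_frame[of q "q(''r'' := v)"]
      by (auto simp: solved_def stamped_def work_vars_def)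
    show "solved (r + 1) (sem (phase ce) q)"
      if "0 \<le> r" "r < s ''N'' 0" "solved r q" "q ''r'' 0 = r" for r q
      using solved_step[of r q] that fixed_N[OF s(1)] by auto
    \<comment> \<open>All potentials and owners are initially 0. This means that every column is
      free, and it is dual feasible because costs are nonnegative.\<close>
    show "solved 0 s"
      using s cost_nonneg
      by (auto simp: solved_def stamped_def dual_feasible_def matched_def work_vars_def)
  qed auto
  then show ?thesis using fixed_N[OF s(1)] by simp
qed

end

section \<open>The approximation ratio\<close>

lemma perfect_matching_iff:
  "perfect_matching A B M \<longleftrightarrow> (\<exists>f. bij_betw f A B \<and> M = (\<lambda>x. (x, f x)) ` A)"
proof
  assume M: "perfect_matching A B M"
  define f where "f x = (THE y. (x, y) \<in> M)" for x
  have f: "f x = y" if "(x, y) \<in> M" for x y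
  proof -
    have "inj_on fst M" using M by (simp add: perfect_matching_def matching_def)
    then show ?thesis
      unfolding f_def using that by (intro the_equality) (simp, metis fst_conv inj_onD prod.inject)
  qed
  have eq: "M = (\<lambda>x. (x, f x)) ` A"
  proof (intro set_eqI iffI)
    fix z assume z: "z \<in> M"
    then have "z = (fst z, f (fst z))" using f[of "fst z" "snd z"] by simp
    moreover have "fst z \<in> A" using M z by (auto simp: perfect_matching_def)
    ultimately show "z \<in> (\<lambda>x. (x, f x)) ` A" by blast
  next
    fix z assume "z \<in> (\<lambda>x. (x, f x)) ` A"
    then obtain x where x: "x \<in> A" "z = (x, f x)" by auto
    then have "x \<in> fst ` M" using M by (simp add: perfect_matching_def)
    then show "z \<in> M" using f x by auto
  qed
  have "inj_on f A"
  proof (rule inj_onI)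
    fix x y assume xy: "x \<in> A" "y \<in> A" "f x = f y"
    then have "(x, f x) \<in> M" "(y, f y) \<in> M" using eq by auto
    moreover have "inj_on snd M" using M by (simp add: perfect_matching_def matching_def)
    ultimately show "x = y" using xy(3) by (metis Pair_inject inj_onD snd_conv)
  qed
  moreover have "f ` A = B"
  proof -
    have "snd ` M = B" using M by (simp add: perfect_matching_def)
    then show ?thesis using eq by (auto simp: image_image)
  qed
  ultimately show "\<exists>f. bij_betw f A B \<and> M = (\<lambda>x. (x, f x)) ` A"
    using eq by (auto simp: bij_betw_def)
next
  assume "\<exists>f. bij_betw f A B \<and> M = (\<lambda>x. (x, f x)) ` A"
  then obtain f where "bij_betw f A B" "M = (\<lambda>x. (x, f x)) ` A" by blast
  then show "perfect_matching A B M"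
    by (auto simp: perfect_matching_def matching_def bij_betw_def inj_on_def image_image)
qed

lemma weight_graph: "weight d ((\<lambda>x. (x, f x)) ` A) = (\<Sum>x\<in>A. d x (f x))"
  unfolding weight_def by (subst sum.reindex) (auto simp: inj_on_def)

text \<open>Covering all of \<open>S\<close> uses up all of \<open>A\<close> when the cardinalities
  agree. Zero surplus puts every second stage in this situation, which gives both stages the same
  form.\<close>

lemma left_covering_iff_perfect:
  assumes "finite A" "card A = card S"
  shows "left_covering_matching S A M \<longleftrightarrow> perfect_matching S A M"
proof
  assume M: "left_covering_matching S A M"
  then have i: "inj_on fst M" "inj_on snd M" "fst ` M = S" "snd ` M \<subseteq> A"
    by (auto simp: left_covering_matching_def matching_def)
  then have "card (snd ` M) = card A" using assms by (metis card_image)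
  then have "snd ` M = A" using i assms by (metis card_subset_eq)
  then show "perfect_matching S A M"
    using M by (simp add: left_covering_matching_def perfect_matching_def)
qed (simp add: left_covering_matching_def perfect_matching_def)

lemma min_matching:
  assumes "finite A" "finite B" "card A = card B"
  shows "bij_betw f A B \<Longrightarrow> Min (weight d ` {M. perfect_matching A B M}) \<le> (\<Sum>x\<in>A. d x (f x))"
    and "\<exists>f. bij_betw f A B \<and> (\<Sum>x\<in>A. d x (f x)) = Min (weight d ` {M. perfect_matching A B M})"
proof -
  let ?W = "weight d ` {M. perfect_matching A B M}"
  have "{M. perfect_matching A B M} \<subseteq> Pow (A \<times> B)"
    by (auto simp: perfect_matching_def matching_def)
  then have fin: "finite ?W" using assms by (auto intro: finite_subset)
  have W: "?W = {\<Sum>x\<in>A. d x (f x) | f. bij_betw f A B}"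
    by (auto simp: perfect_matching_iff weight_graph image_iff) (metis weight_graph)
  obtain h where "bij_betw h A B" using assms finite_same_card_bij by blast
  then have "?W \<noteq> {}" using W by auto
  then show "\<exists>f. bij_betw f A B \<and> (\<Sum>x\<in>A. d x (f x)) = Min ?W"
    using Min_in[OF fin] W by auto
  show "Min ?W \<le> (\<Sum>x\<in>A. d x (f x))" if "bij_betw f A B"
    using that W by (intro Min_le[OF fin]) auto
qed

section \<open>Moving one point set onto another within a metric\<close>

definition transport :: "('a \<Rightarrow> 'a \<Rightarrow> rat) \<Rightarrow> 'a set \<Rightarrow> 'a set \<Rightarrow> rat \<Rightarrow> bool" where
  "transport d A B w \<longleftrightarrow> (\<exists>f. bij_betw f A B \<and> (\<Sum>x\<in>A. d x (f x)) \<le> w)"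

lemma transport_sym:
  assumes "metric_on V d" "A \<subseteq> V" "B \<subseteq> V" "transport d A B w"
  shows "transport d B A w"
proof -
  obtain f where f: "bij_betw f A B" "(\<Sum>x\<in>A. d x (f x)) \<le> w"
    using assms by (auto simp: transport_def)
  let ?g = "the_inv_into A f"
  have g: "bij_betw ?g B A" using f(1) by (rule bij_betw_the_inv_into)
  have "(\<Sum>y\<in>B. d y (?g y)) = (\<Sum>x\<in>A. d (f x) (?g (f x)))"
    using sum.reindex_bij_betw[OF f(1), of "\<lambda>y. d y (?g y)"] by simp
  also have "\<dots> = (\<Sum>x\<in>A. d x (f x))"
  proof (intro sum.cong refl)
    fix x assume x: "x \<in> A"
    then have "?g (f x) = x" using f by (simp add: bij_betw_def the_inv_into_f_f)
    moreover have "x \<in> V" "f x \<in> V" using x assms bij_betwE[OF f(1)] by auto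
    ultimately show "d (f x) (?g (f x)) = d x (f x)" using assms by (simp add: metric_on_def)
  qed
  finally show ?thesis using f g by (auto simp: transport_def)
qed

lemma transport_trans:
  assumes "metric_on V d" "A \<subseteq> V" "B \<subseteq> V" "D \<subseteq> V" "transport d A B v" "transport d B D w"
  shows "transport d A D (v + w)"
proof -
  obtain f g where f: "bij_betw f A B" "(\<Sum>x\<in>A. d x (f x)) \<le> v"
    and g: "bij_betw g B D" "(\<Sum>x\<in>B. d x (g x)) \<le> w"
    using assms by (auto simp: transport_def)
  have "(\<Sum>x\<in>A. d x ((g \<circ> f) x)) \<le> (\<Sum>x\<in>A. d x (f x) + d (f x) (g (f x)))"
  proof (intro sum_mono)
    fix x assume "x \<in> A"
    then have "x \<in> V" "f x \<in> V" "g (f x) \<in> V" 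
      using assms(2-4) bij_betwE[OF f(1)] bij_betwE[OF g(1)] by auto
    then show "d x ((g \<circ> f) x) \<le> d x (f x) + d (f x) (g (f x))"
      using assms(1) by (simp add: metric_on_def)
  qed
  also have "\<dots> = (\<Sum>x\<in>A. d x (f x)) + (\<Sum>y\<in>B. d y (g y))"
    using sum.reindex_bij_betw[OF f(1), of "\<lambda>y. d y (g y)"] by (simp add: sum.distrib)
  also have "\<dots> \<le> v + w" using f g by simp
  finally show ?thesis using f g bij_betw_trans unfolding transport_def by blast
qed

text \<open>A common point \<open>z\<close> can be cut out: whatever is sent to \<open>z\<close> is
  sent on directly to the image of \<open>z\<close>, and by the triangle inequality this does not
  raise the cost. Induction removes all common points.\<close>

lemma transport_diff:
  assumes "metric_on V d" "finite A" "A \<subseteq> V" "B \<subseteq> V" "transport d A B w"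
  shows "transport d (A - B) (B - A) w"
  using assms(2-)
proof (induction "card (A \<inter> B)" arbitrary: A B)
  case 0
  then have "A - B = A" "B - A = B" by auto
  then show ?case using 0 by simp
next
  case (Suc n)
  then obtain z where z: "z \<in> A" "z \<in> B"
    by (metis IntE all_not_in_conv card.empty nat.distinct(1))
  obtain f where f: "bij_betw f A B" "(\<Sum>x\<in>A. d x (f x)) \<le> w"
    using Suc.prems by (auto simp: transport_def)
  obtain a where a: "a \<in> A" "f a = z" using f(1) z by (auto simp: bij_betw_def)
  have V: "x \<in> V" "f x \<in> V" if "x \<in> A" for x using that Suc.prems bij_betwE[OF f(1)] by auto
  have "transport d (A - {z}) (B - {z}) w"
  proof (cases "a = z")
    case True
    then have "bij_betw f (A - {z}) (B - {z})"
      using bij_betw_DiffI[OF f(1), of "{z}" "{z}"] a z by (auto simp: bij_betw_def)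
    moreover have "(\<Sum>x\<in>A - {z}. d x (f x)) \<le> (\<Sum>x\<in>A. d x (f x))"
      using V assms(1) Suc.prems by (intro sum_mono2) (auto simp: metric_on_def)
    ultimately show ?thesis using f by (auto simp: transport_def)
  next
    case False
    let ?h = "f(a := f z)"
    have inj: "inj_on f A" using f by (simp add: bij_betw_def)
    have "inj_on ?h (A - {z})"
      using inj a z by (auto simp: inj_on_def)
    moreover have "?h ` (A - {z}) = B - {z}"
    proof -
      have "?h ` (A - {z}) = insert (f z) (f ` (A - {z, a}))" using False a by auto
      also have "f ` (A - {z, a}) = B - {f z, z}"
        using inj a z f(1) by (auto simp: bij_betw_def inj_on_def)
      also have "insert (f z) (B - {f z, z}) = B - {z}"
        using False inj a z bij_betwE[OF f(1)] by (auto simp: inj_on_def)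
      finally show ?thesis .
    qed
    ultimately have "bij_betw ?h (A - {z}) (B - {z})" by (simp add: bij_betw_def)
    moreover have "(\<Sum>x\<in>A - {z}. d x (?h x)) \<le> (\<Sum>x\<in>A. d x (f x))"
    proof -
      have "(\<Sum>x\<in>A - {z}. d x (?h x)) = d a (f z) + (\<Sum>x\<in>A - {z} - {a}. d x (f x))"
        using Suc.prems a False by (subst sum.remove[of _ a]) auto
      \<comment> \<open>The terms of \<open>a\<close> and \<open>z\<close> are isolated: together
        they are the detour from \<open>a\<close> through \<open>z\<close> that \<open>?h\<close>
        replaces by the direct way.\<close>
      moreover have "(\<Sum>x\<in>A. d x (f x)) = d z (f z) + (d a z + (\<Sum>x\<in>A - {z} - {a}. d x (f x)))"
        using Suc.prems a z False by (subst sum.remove[of _ z], simp, simp) (subst sum.remove[of _ a], auto)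
      moreover have "d a (f z) \<le> d a z + d z (f z)"
        using V a z assms(1) by (simp add: metric_on_def)
      ultimately show ?thesis by linarith
    qed
    ultimately show ?thesis using f by (auto simp: transport_def)
  qed
  moreover have "n = card ((A - {z}) \<inter> (B - {z}))"
  proof -
    have "(A - {z}) \<inter> (B - {z}) = A \<inter> B - {z}" by auto
    then show ?thesis using Suc.hyps(2) z Suc.prems by simp
  qed
  moreover have "A - {z} - (B - {z}) = A - B" "B - {z} - (A - {z}) = B - A" using z by auto
  ultimately show ?case using Suc.hyps(1)[of "A - {z}" "B - {z}"] Suc.prems by auto
qed

text \<open>Points common to both complements may stay where they are.\<close>

lemma transport_complement:
  assumes d: "metric_on V d" and D: "finite D" "D \<subseteq> V" "A \<subseteq> D" "B \<subseteq> D" and "transport d A B w"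
  shows "transport d (D - B) (D - A) w"
proof -
  have "transport d (A - B) (B - A) w"
    using assms by (intro transport_diff[OF d]) (auto intro: finite_subset)
  then obtain f where f: "bij_betw f (A - B) (B - A)" "(\<Sum>x\<in>A - B. d x (f x)) \<le> w"
    by (auto simp: transport_def)
  let ?E = "D - A - B"
  let ?h = "\<lambda>x. if x \<in> A - B then f x else x"
  have "bij_betw ?h ((A - B) \<union> ?E) ((B - A) \<union> ?E)"
    using f(1) by (intro bij_betw_combine) (auto cong: bij_betw_cong simp: bij_betw_def inj_on_def)
  moreover have "(A - B) \<union> ?E = D - B" "(B - A) \<union> ?E = D - A" using D by auto
  ultimately have "bij_betw ?h (D - B) (D - A)" by simp
  moreover have "(\<Sum>x\<in>D - B. d x (?h x)) = (\<Sum>x\<in>A - B. d x (f x))"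
  proof -
    have "d x x = 0" if "x \<in> D" for x using d D that by (auto simp: metric_on_def)
    then show ?thesis using D by (intro sum.mono_neutral_cong_right) auto
  qed
  ultimately show ?thesis using f(2) by (auto simp: transport_def)
qed

lemma two_approximation:
  fixes I :: "'a tsrm"
  assumes inst: "tsrm_instance I" and unif: "uniform_scenarios I k" and sur: "surplus I k = 0"
    and S: "S \<in> set (scenarios I)" and D1: "D1 \<subseteq> drivers I"
    and a: "bij_betw a (riders1 I) D1" and b: "bij_betw b S (drivers I - D1)"
    and least: "\<And>D2 a' b'. \<lbrakk>D2 \<subseteq> drivers I; bij_betw a' (riders1 I) D2; bij_betw b' S (drivers I - D2)\<rbrakk> \<Longrightarrow>
      3 * (\<Sum>x\<in>riders1 I. distance I x (a x)) + (\<Sum>x\<in>S. distance I x (b x))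
      \<le> 3 * (\<Sum>x\<in>riders1 I. distance I x (a' x)) + (\<Sum>x\<in>S. distance I x (b' x))"
  shows "feasible I D1" "total_cost I D1 \<le> 2 * OPT I" "0 \<le> OPT I"
proof -
  define d D R V where "d = distance I" and "D = drivers I" and "R = riders1 I" and "V = points I"
  have met: "metric_on V d" and fin: "finite D" "finite R" 
    and sub: "D \<subseteq> V" "R \<subseteq> V" and ne: "scenarios I \<noteq> []"
    using inst by (auto simp: tsrm_instance_def d_def D_def R_def V_def points_def)
  have sc: "finite T" "T \<subseteq> V" "card T = k" if "T \<in> set (scenarios I)" for T
  proof -
    have "T \<subseteq> riders2 I" "finite (riders2 I)" using that inst by (auto simp: tsrm_instance_def)
    then show "finite T" "T \<subseteq> V" by (auto intro: finite_subset simp: V_def points_def)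
    show "card T = k" using that unif by (simp add: uniform_scenarios_def)
  qed
  have dnn: "0 \<le> d x y" if "x \<in> V" "y \<in> V" for x y using met that by (simp add: metric_on_def)
  have feas: "feasible I E \<longleftrightarrow> E \<subseteq> D \<and> card E = card R" for E by (simp add: feasible_def D_def R_def)
  have card: "card (D - E) = k" if "feasible I E" for E
    using that sur fin by (auto simp: feas surplus_def D_def R_def card_Diff_subset finite_subset)
  show f1: "feasible I D1" using D1 bij_betw_same_card[OF a] by (auto simp: feas D_def R_def)
  have cost1: "transport d R E (cost1 I E)" "\<And>w. transport d R E w \<Longrightarrow> cost1 I E \<le> w"
    if "feasible I E" for E
  proof -
    have E: "finite E" "card R = card E" using that fin by (auto simp: feas finite_subset)
    show "transport d R E (cost1 I E)" "\<And>w. transport d R E w \<Longrightarrow> cost1 I E \<le> w"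
      using min_matching[OF fin(2) E, where d = d]
      by (force simp: transport_def cost1_def R_def d_def)+
  qed
  have cost2: "transport d T (D - E) (cost2 I (D - E) T)"
    "\<And>w. transport d T (D - E) w \<Longrightarrow> cost2 I (D - E) T \<le> w"
    if "feasible I E" "T \<in> set (scenarios I)" for E T
  proof -
    have E: "finite (D - E)" "card T = card (D - E)" using card[OF that(1)] fin sc that by auto
    show "transport d T (D - E) (cost2 I (D - E) T)"
      "\<And>w. transport d T (D - E) w \<Longrightarrow> cost2 I (D - E) T \<le> w"
      using min_matching[OF sc(1)[OF that(2)] E, where d = d]
      unfolding cost2_def left_covering_iff_perfect[OF E(1) E(2)[symmetric]]
      by (force simp: transport_def d_def)+
  qed
  have nonneg: "0 \<le> w" if t: "transport d A B w" "A \<subseteq> V" "B \<subseteq> V" for A B w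
  proof -
    obtain f where f: "bij_betw f A B" "(\<Sum>x\<in>A. d x (f x)) \<le> w" using t by (auto simp: transport_def)
    have "0 \<le> (\<Sum>x\<in>A. d x (f x))"
      using t bij_betwE[OF f(1)] by (intro sum_nonneg dnn) auto
    then show ?thesis using f by simp
  qed
  have finfeas: "finite {E. feasible I E}"
    by (rule finite_subset[of _ "Pow D"]) (use fin in \<open>auto simp: feas\<close>)
  then have "OPT I \<in> total_cost I ` {E. feasible I E}"
    unfolding OPT_def using f1 by (intro Min_in) auto
  then obtain D2 where f2: "feasible I D2" and opt: "OPT I = total_cost I D2" by auto
  define y where "y = Max ((\<lambda>T. cost2 I (D - D2) T) ` set (scenarios I))"
  have opt: "OPT I = cost1 I D2 + y" using opt by (simp add: total_cost_def y_def D_def)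
  have y: "cost2 I (D - D2) T \<le> y" if "T \<in> set (scenarios I)" for T
    unfolding y_def using that by (intro Max_ge) auto
  have V: "D1 \<subseteq> V" "D2 \<subseteq> V" "D - D1 \<subseteq> V" "D - D2 \<subseteq> V" "D1 \<subseteq> D" "D2 \<subseteq> D"
    using f1 f2 sub by (auto simp: feas)
  have c0: "0 \<le> cost1 I D2" using nonneg[OF cost1(1)[OF f2]] V sub by simp
  have "0 \<le> cost2 I (D - D2) S" using nonneg[OF cost2(1)[OF f2 S]] V sc S by simp
  then have y0: "0 \<le> y" using y[OF S] by simp
  show "0 \<le> OPT I" using opt c0 y0 by simp
  define p q where "p = (\<Sum>x\<in>R. d x (a x))" and "q = (\<Sum>x\<in>S. d x (b x))"
  have p: "transport d R D1 p" and q: "transport d S (D - D1) q"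
    using a b by (auto simp: transport_def p_def q_def R_def D_def)
  have lp: "3 * p + q \<le> 3 * cost1 I D2 + cost2 I (D - D2) S"
  proof -
    obtain a' b' where "bij_betw a' R D2" "(\<Sum>x\<in>R. d x (a' x)) \<le> cost1 I D2"
      "bij_betw b' S (D - D2)" "(\<Sum>x\<in>S. d x (b' x)) \<le> cost2 I (D - D2) S"
      using cost1(1)[OF f2] cost2(1)[OF f2 S] by (auto simp: transport_def)
    then show ?thesis using least[of D2 a' b'] V
      by (auto simp: p_def q_def R_def D_def d_def)
  qed
  have t1: "transport d (D - D2) (D - D1) (p + cost1 I D2)"
  proof -
    have "transport d D1 D2 (p + cost1 I D2)"
      using transport_trans[OF met V(1) sub(2) V(2) transport_sym[OF met sub(2) V(1) p] cost1(1)[OF f2]] .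
    then show ?thesis by (rule transport_complement[OF met fin(1) sub(1) V(5,6)])
  qed
  have t2: "transport d (D - D2) (D - D1) (cost2 I (D - D2) S + q)"
    using transport_trans[OF met V(4) sc(2)[OF S] V(3) transport_sym[OF met sc(2)[OF S] V(4) cost2(1)[OF f2 S]] q] .
  \<comment> \<open>Scenario \<open>T\<close> is matched to the complement of \<open>D2\<close> as
    in the optimum and then carried to the complement of \<open>D1\<close>, at the cost of either
    \<open>t1\<close> or \<open>t2\<close>; the minimum of the two is at most their mean.\<close>
  have bound: "cost2 I (D - D1) T \<le> y + (p + q + cost1 I D2 + y) / 2" if T: "T \<in> set (scenarios I)" for T
  proof -
    have "cost2 I (D - D1) T \<le> cost2 I (D - D2) T + (p + cost1 I D2)"
      "cost2 I (D - D1) T \<le> cost2 I (D - D2) T + (cost2 I (D - D2) S + q)"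
      using transport_trans[OF met sc(2)[OF T] V(4) V(3) cost2(1)[OF f2 T]] t1 t2
      by (auto intro!: cost2(2)[OF f1 T])
    then show ?thesis using y[OF S] y[OF T] by (simp add: field_simps)
  qed
  have "Max ((\<lambda>T. cost2 I (D - D1) T) ` set (scenarios I)) \<le> y + (p + q + cost1 I D2 + y) / 2"
    using ne bound by (intro Max.boundedI) auto
  moreover have "cost1 I D1 \<le> p" by (rule cost1(2)[OF f1 p])
  ultimately have "total_cost I D1 \<le> p + (y + (p + q + cost1 I D2 + y) / 2)"
    by (simp add: total_cost_def D_def)
  \<comment> \<open>The left side equals (3 p + q) / 2 + 3 y / 2 + \<open>cost1 I D2\<close> / 2. By
    \<open>lp\<close>, 3 p + q is at most 3 \<open>cost1 I D2\<close> + y, and the total becomes 2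
    \<open>cost1 I D2\<close> + 2 y.\<close>
  also have "\<dots> \<le> 2 * OPT I" using lp y[OF S] opt by (simp add: field_simps)
  finally show "total_cost I D1 \<le> 2 * OPT I" .
qed


lemma sum_the_inv_into:
  assumes "bij_betw f A B"
  shows "(\<Sum>x\<in>B. g x (h (the_inv_into A f x))) = (\<Sum>i\<in>A. g (f i) (h i))"
proof -
  have "(\<Sum>x\<in>B. g x (h (the_inv_into A f x))) = (\<Sum>i\<in>A. g (f i) (h (the_inv_into A f (f i))))"
    using sum.reindex_bij_betw[OF assms, of "\<lambda>x. g x (h (the_inv_into A f x))"] by simp
  also have "\<dots> = (\<Sum>i\<in>A. g (f i) (h i))"
    using assms by (intro sum.cong) (auto simp: bij_betw_def the_inv_into_f_f)
  finally show ?thesis .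
qed

text \<open>Rows below \<open>R\<close> stand for first-stage riders and carry weight 3, the others
  stand for the members of \<open>S\<close>; columns are the drivers. A permutation thus encodes
  both a choice of \<open>D1\<close> and the matchings of both stages, and the positive factor
  \<open>c\<close> does not affect which permutation is best.\<close>

lemma optimal_assignment_two_approximation:
  fixes I :: "'a tsrm" and C :: "int \<Rightarrow> int \<Rightarrow> int" and N R :: int and c :: rat
  assumes inst: "tsrm_instance I" "uniform_scenarios I k" "surplus I k = 0"
    and S: "S \<in> set (scenarios I)"
    and R: "0 \<le> R" "R \<le> N"
    and row1: "bij_betw row {0..<R} (riders1 I)" and row2: "bij_betw row {R..<N} S"
    and col: "bij_betw col {0..<N} (drivers I)"
    and c: "0 < c"
    and C: "\<And>i j. \<lbrakk>0 \<le> i; i < N; 0 \<le> j; j < N\<rbrakk> \<Longrightarrow>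
      of_int (C i j) = c * ((if i < R then 3 else 1) * distance I (row i) (col j))"
    and m: "bij_betw m {0..<N} {0..<N}"
    and least: "\<And>f. bij_betw f {0..<N} {0..<N} \<Longrightarrow>
      (\<Sum>i\<in>{0..<N}. C i (m i)) \<le> (\<Sum>i\<in>{0..<N}. C i (f i))"
  shows "feasible I (col ` m ` {0..<R})" "total_cost I (col ` m ` {0..<R}) \<le> 2 * OPT I" "0 \<le> OPT I"
proof -
  let ?d = "distance I"
  let ?p1 = "the_inv_into {0..<R} row" and ?p2 = "the_inv_into {R..<N} row"
  let ?D1 = "col ` m ` {0..<R}"
  have split: "{0..<N} = {0..<R} \<union> {R..<N}" "{0..<R} \<inter> {R..<N} = {}" using R by auto
  have cost: "of_int (\<Sum>i\<in>{0..<N}. C i (f i)) =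
      c * (3 * (\<Sum>i\<in>{0..<R}. ?d (row i) (col (f i))) + (\<Sum>i\<in>{R..<N}. ?d (row i) (col (f i))))"
    if "bij_betw f {0..<N} {0..<N}" for f
  proof -
    have "of_int (\<Sum>i\<in>{0..<N}. C i (f i)) =
        (\<Sum>i\<in>{0..<N}. c * ((if i < R then 3 else 1) * ?d (row i) (col (f i))))"
      unfolding of_int_sum using bij_betwE[OF that] by (intro sum.cong) (auto simp: C)
    also have "\<dots> = (\<Sum>i\<in>{0..<R}. c * (3 * ?d (row i) (col (f i)))) +
        (\<Sum>i\<in>{R..<N}. c * ?d (row i) (col (f i)))"
      unfolding split(1) by (subst sum.union_disjoint) auto
    finally show ?thesis by (simp add: sum_distrib_left distrib_left)
  qed
  have cm: "bij_betw (col \<circ> m) {0..<N} (drivers I)" by (rule bij_betw_trans[OF m col])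
  have cm1: "bij_betw (col \<circ> m) {0..<R} ?D1"
    using cm split by (auto intro: bij_betw_subset simp: image_comp)
  have sub: "?D1 \<subseteq> drivers I" using cm split by (auto simp: bij_betw_def)
  have cm2: "bij_betw (col \<circ> m) {R..<N} (drivers I - ?D1)"
  proof -
    have "{R..<N} = {0..<N} - {0..<R}" using R by auto
    moreover have "bij_betw (col \<circ> m) ({0..<N} - {0..<R}) (drivers I - ?D1)"
      by (rule bij_betw_DiffI[OF cm cm1]) (use sub R in auto)
    ultimately show ?thesis by simp
  qed
  have a: "bij_betw ((col \<circ> m) \<circ> ?p1) (riders1 I) ?D1"
    by (rule bij_betw_trans[OF bij_betw_the_inv_into[OF row1] cm1])
  have b: "bij_betw ((col \<circ> m) \<circ> ?p2) S (drivers I - ?D1)"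
    by (rule bij_betw_trans[OF bij_betw_the_inv_into[OF row2] cm2])
  have main: "3 * (\<Sum>x\<in>riders1 I. ?d x (((col \<circ> m) \<circ> ?p1) x)) + (\<Sum>x\<in>S. ?d x (((col \<circ> m) \<circ> ?p2) x))
      \<le> 3 * (\<Sum>x\<in>riders1 I. ?d x (a' x)) + (\<Sum>x\<in>S. ?d x (b' x))"
    if D2: "D2 \<subseteq> drivers I" "bij_betw a' (riders1 I) D2" "bij_betw b' S (drivers I - D2)"
    for D2 a' b'
  proof -
    \<comment> \<open>The competitor \<open>D2\<close> with its two matchings is glued into one
      bijection from rows to drivers; pulled back along \<open>col\<close> it is a permutation to
      which \<open>least\<close> applies.\<close>
    let ?g = "\<lambda>i. if i \<in> {0..<R} then a' (row i) else b' (row i)"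
    have "bij_betw ?g ({0..<R} \<union> {R..<N}) (D2 \<union> (drivers I - D2))"
    proof (rule bij_betw_combine)
      have "bij_betw (a' \<circ> row) {0..<R} D2" by (rule bij_betw_trans[OF row1 D2(2)])
      then show "bij_betw ?g {0..<R} D2" by (rule iffD1[OF bij_betw_cong, rotated]) auto
      have "bij_betw (b' \<circ> row) {R..<N} (drivers I - D2)" by (rule bij_betw_trans[OF row2 D2(3)])
      then show "bij_betw ?g {R..<N} (drivers I - D2)" by (rule iffD1[OF bij_betw_cong, rotated]) auto
    qed auto
    moreover have "D2 \<union> (drivers I - D2) = drivers I" using D2 by auto
    ultimately have g: "bij_betw ?g {0..<N} (drivers I)" using split by simp
    define f where "f = the_inv_into {0..<N} col \<circ> ?g"
    have f: "bij_betw f {0..<N} {0..<N}"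
      unfolding f_def by (rule bij_betw_trans[OF g bij_betw_the_inv_into[OF col]])
    have cf: "col (f i) = ?g i" if "i \<in> {0..<N}" for i
      using f_the_inv_into_f_bij_betw[OF col, of "?g i"] bij_betwE[OF g] that by (simp add: f_def)
    have "of_int (\<Sum>i\<in>{0..<N}. C i (m i)) \<le> (of_int (\<Sum>i\<in>{0..<N}. C i (f i)) :: rat)"
      using least[OF f] by (simp only: of_int_le_iff)
    then have "3 * (\<Sum>i\<in>{0..<R}. ?d (row i) (col (m i))) + (\<Sum>i\<in>{R..<N}. ?d (row i) (col (m i)))
        \<le> 3 * (\<Sum>i\<in>{0..<R}. ?d (row i) (col (f i))) + (\<Sum>i\<in>{R..<N}. ?d (row i) (col (f i)))"
      unfolding cost[OF m] cost[OF f] using c by simp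
    moreover have "(\<Sum>i\<in>{0..<R}. ?d (row i) (col (f i))) = (\<Sum>i\<in>{0..<R}. ?d (row i) (a' (row i)))"
      using cf R by (intro sum.cong) auto
    moreover have "(\<Sum>i\<in>{R..<N}. ?d (row i) (col (f i))) = (\<Sum>i\<in>{R..<N}. ?d (row i) (b' (row i)))"
      using cf R by (intro sum.cong) auto
    ultimately show ?thesis
      using sum_the_inv_into[OF row1, of ?d "col \<circ> m"] sum_the_inv_into[OF row2, of ?d "col \<circ> m"]
        sum.reindex_bij_betw[OF row1, of "\<lambda>x. ?d x (a' x)"]
        sum.reindex_bij_betw[OF row2, of "\<lambda>x. ?d x (b' x)"] by simp
  qed
  show "feasible I ?D1" "total_cost I ?D1 \<le> 2 * OPT I" "0 \<le> OPT I"
    by (rule two_approximation[OF inst S sub a b main]; assumption)+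
qed

section \<open>The program\<close>

abbreviation num_points :: aexp where
  "num_points \<equiv> Cell ''in'' (Lit 1)"

text \<open>\<open>b\<close>, \<open>a\<close> and \<open>z\<close> are the addresses of the numbers of drivers, of first-stage riders and of
  scenarios; \<open>q\<close> becomes the product of all denominators.\<close>

definition locate :: prog where
  "locate =
     Block (assign ''w'' (Mul num_points num_points))
    (Block (assign ''b'' (Add (Lit 2) (Add (scalar ''w'') (scalar ''w''))))
    (Block (assign ''N'' (Cell ''in'' (scalar ''b'')))
    (Block (assign ''a'' (Add (scalar ''b'') (Add (scalar ''N'') (Lit 1))))
    (Block (assign ''R'' (Cell ''in'' (scalar ''a'')))
    (Block (assign ''z'' (Add (scalar ''a'') (Add (scalar ''R'') (Lit 1))))
    (Block (assign ''z'' (Add (scalar ''z'') (Add (Cell ''in'' (scalar ''z'')) (Lit 1))))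
       (assign ''q'' (Lit 1))))))))"

text \<open>Numerators and denominators alternate from index 2 on, so denominators sit at
  \<open>3 + 2 x\<close>. The plain product is a common multiple that can be formed by multiplying
  with input entries only.\<close>

definition common_denominator :: prog where
  "common_denominator =
     For_upto ''x'' ''w''
       (assign ''q'' (Mul (Cell ''in'' (Add (Lit 3) (Add (scalar ''x'') (scalar ''x'')))) (scalar ''q'')))"

text \<open>\<open>s\<close> holds the point of each row and \<open>l\<close> its weight times the
  common denominator. Three times \<open>q\<close> is written as a sum because \<open>safe\<close>
  requires an input entry as left factor. The offset 2 after \<open>z\<close> skips the number of
  scenarios and the size of the first one.\<close>

definition fill_rows :: prog where
  "fill_rows =
     For_upto ''x'' ''N''
       (Branch (Less (scalar ''x'') (scalar ''R''))
          (Block (Assign ''s'' (scalar ''x'') (Cell ''in'' (Add (scalar ''a'') (Add (Lit 1) (scalar ''x'')))))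
             (Assign ''l'' (scalar ''x'') (Add (scalar ''q'') (Add (scalar ''q'') (scalar ''q'')))))
          (Block (Assign ''s'' (scalar ''x'')
                (Cell ''in'' (Add (scalar ''z'') (Add (Lit 2) (Sub (scalar ''x'') (scalar ''R''))))))
             (Assign ''l'' (scalar ''x'') (scalar ''q''))))"

text \<open>\<open>e\<close> is the position of the pair in the distance table. Dividing the scaled
  weight by the denominator before multiplying keeps the product within \<open>safe\<close>; the
  division is exact.\<close>

definition edge_cost :: aexp where
  "edge_cost =
     (let e = Add (Mul num_points (Cell ''s'' (scalar ''i'')))
                (Cell ''in'' (Add (scalar ''b'') (Add (Lit 1) (scalar ''j''))))
      in Mul (Cell ''in'' (Add (Lit 2) (Add e e)))
           (Div (Cell ''l'' (scalar ''i'')) (Cell ''in'' (Add (Lit 3) (Add e e)))))"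

text \<open>\<open>o\<close> stores the owner row plus one, so the test asks for an owner below
  \<open>R\<close>, a first-stage rider. Cell 0 of \<open>out\<close> is the length of the output
  and, after the increment, the address of its new last entry.\<close>

definition emit :: prog where
  "emit =
     For_upto ''x'' ''N''
       (Branch (Less (Cell ''o'' (scalar ''x'')) (Add (scalar ''R'') (Lit 1)))
          (Block (assign ''out'' (Add (scalar ''out'') (Lit 1)))
             (Assign ''out'' (scalar ''out'')
                (Cell ''in'' (Add (scalar ''b'') (Add (Lit 1) (scalar ''x''))))))
          Nop)"

definition matching_program :: prog where
  "matching_program =
     Block locate (Block common_denominator (Block fill_rows (Block (hungarian edge_cost) emit)))"

lemma writes_locate [simp]: "writes locate = {''w'', ''b'', ''N'', ''a'', ''R'', ''z'', ''q''}"
  by (auto simp: locate_def)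

lemma writes_common_denominator [simp]: "writes common_denominator = {''x'', ''q''}"
  by (auto simp: common_denominator_def)

lemma writes_fill_rows [simp]: "writes fill_rows = {''x'', ''s'', ''l''}"
  by (auto simp: fill_rows_def)

lemma writes_emit [simp]: "writes emit = {''x'', ''out''}"
  by (auto simp: emit_def)


lemma wf_matching_program: "wf_prog matching_program" "''in'' \<notin> writes matching_program"
  by (auto simp: matching_program_def locate_def common_denominator_def fill_rows_def emit_def
      edge_cost_def work_vars_def Let_def)

section \<open>Layout of the encoded input\<close>

lemma array_of_segment:
  "array_of (xs @ ys @ zs) (int (length xs) + 1 + int j) = ys ! j" if "j < length ys"
proof -
  have "nat (int (length xs) + 1 + int j - 1) = length xs + j" by simp
  then show ?thesis using that by (simp add: array_of_def nth_append)
qed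

lemma length_concat_map:
  "(\<And>x. x \<in> set xs \<Longrightarrow> length (f x) = c) \<Longrightarrow> length (concat (map f xs)) = c * length xs"
  by (induction xs) auto

lemma nth_concat_map:
  assumes "\<And>x. x \<in> set xs \<Longrightarrow> length (f x) = c" "i < length xs" "j < c"
  shows "concat (map f xs) ! (c * i + j) = f (xs ! i) ! j"
  using assms
proof (induction xs arbitrary: i)
  case (Cons x xs)
  show ?case
  proof (cases i)
    case 0
    then show ?thesis using Cons.prems by (simp add: nth_append)
  next
    case (Suc i')
    then have "concat (map f xs) ! (c * i' + j) = f (xs ! i') ! j"
      using Cons.prems by (intro Cons.IH) auto
    then show ?thesis using Suc Cons.prems by (simp add: nth_append add.assoc)
  qed
qed simp

lemma index_list_points:
  "map (\<lambda>z. pts ! nat z) (index_list pts A) = filter (\<lambda>x. x \<in> A) pts"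
proof -
  have "filter (\<lambda>x. x \<in> A) pts = filter (\<lambda>x. x \<in> A) (map ((!) pts) [0..<length pts])"
    by (simp only: map_nth)
  also have "\<dots> = map ((!) pts) (filter (\<lambda>i. pts ! i \<in> A) [0..<length pts])"
    by (simp only: filter_map o_def)
  finally show ?thesis by (simp add: index_list_def o_def)
qed

lemma index_list_bij:
  assumes "distinct pts" "A \<subseteq> set pts"
  shows "bij_betw (\<lambda>j. pts ! nat (index_list pts A ! j)) {..<length (index_list pts A)} A"
proof -
  let ?xs = "map (\<lambda>z. pts ! nat z) (index_list pts A)"
  have "distinct ?xs" "set ?xs = A" using assms unfolding index_list_points by auto
  then have "bij_betw ((!) ?xs) {..<length ?xs} A" using bij_betw_nth by blast
  then have "bij_betw ((!) ?xs) {..<length (index_list pts A)} A" by simp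
  then show ?thesis by (rule iffD1[OF bij_betw_cong, rotated]) simp
qed

lemma index_list_range: "z \<in> set (index_list pts A) \<Longrightarrow> 0 \<le> z \<and> nat z < length pts"
  by (auto simp: index_list_def)

lemma index_list_subset:
  "B \<subseteq> A \<Longrightarrow> index_list pts B = filter (\<lambda>z. pts ! nat z \<in> B) (index_list pts A)"
  unfolding index_list_def filter_map filter_filter
  by (intro arg_cong[where f = "map int"] filter_cong) (auto simp: o_def)

lemma bij_betw_int_lessThan: "bij_betw nat {0..<int n} {..<n}"
  by (rule bij_betw_byWitness[where f' = int]) auto

locale encoded_instance =
  fixes I :: "'a tsrm" and pts :: "'a list" and k :: nat
  assumes inst: "tsrm_instance I" "uniform_scenarios I k" "surplus I k = 0"
    and enum: "enumerates pts I"
begin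

definition n :: nat where "n = length pts"
definition dl :: "int list" where "dl = index_list pts (drivers I)"
definition rl :: "int list" where "rl = index_list pts (riders1 I)"
definition r2l :: "int list" where "r2l = index_list pts (riders2 I)"
definition S1 :: "'a set" where "S1 = hd (scenarios I)"
definition sl :: "int list" where "sl = index_list pts S1"
definition input :: "int \<Rightarrow> int" where "input = array_of (encode pts I)"
text \<open>Index 0 holds the length of the input and index 1 the number of points; two numbers for
  each of the \<open>n * n\<close> distances follow.\<close>

definition base_d :: int where "base_d = 2 + (int n * int n + int n * int n)"
definition base_r :: int where "base_r = base_d + (int (length dl) + 1)"
definition base_s :: int where "base_s = base_r + (int (length rl) + 1) + (int (length r2l) + 1)"

lemma S1: "S1 \<in> set (scenarios I)"
  using inst(1) by (auto simp: tsrm_instance_def S1_def)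

lemma points_subset: "drivers I \<subseteq> set pts" "riders1 I \<subseteq> set pts" "S1 \<subseteq> set pts" "distinct pts"
  using enum inst(1) S1 by (auto simp: enumerates_def points_def tsrm_instance_def)

definition dists :: "int list" where
  "dists = concat (map (\<lambda>x. concat (map (\<lambda>y. encode_rat (distance I x y)) pts)) pts)"

lemma dists_row_length: "length (concat (map (\<lambda>y. encode_rat (distance I x y)) pts)) = 2 * n"
  unfolding n_def by (rule length_concat_map) (simp add: encode_rat_def)

lemma dists_length: "length dists = 2 * n * n"
  unfolding dists_def using dists_row_length by (subst length_concat_map) (auto simp: n_def)

lemma dists_nth:
  assumes "x < n" "y < n" "j < 2"
  shows "dists ! (2 * (n * x + y) + j) = encode_rat (distance I (pts ! x) (pts ! y)) ! j"
proof -
  have "2 * y + j < 2 * n" using assms by linarith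
  then have "dists ! (2 * n * x + (2 * y + j)) =
      concat (map (\<lambda>y. encode_rat (distance I (pts ! x) y)) pts) ! (2 * y + j)"
    unfolding dists_def using assms dists_row_length by (intro nth_concat_map) (auto simp: n_def)
  also have "\<dots> = encode_rat (distance I (pts ! x) (pts ! y)) ! j"
    using assms by (intro nth_concat_map) (auto simp: n_def encode_rat_def)
  finally show ?thesis by (simp add: algebra_simps)
qed

definition rest :: "int list" where
  "rest = concat (map (encode_set pts) (tl (scenarios I)))"

text \<open>Only the first scenario is displayed, as it is the one that the assignment problem uses;
  the others disappear in \<open>rest\<close>.\<close>

lemma encode_split:
  "encode pts I = [int n] @ dists @ (int (length dl) # dl) @ (int (length rl) # rl) @
     (int (length r2l) # r2l) @ (int (length (scenarios I)) # int (length sl) # sl) @ rest"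
proof -
  have "scenarios I = S1 # tl (scenarios I)"
    using inst(1) by (simp add: tsrm_instance_def S1_def)
  then have "concat (map (encode_set pts) (scenarios I)) = encode_set pts S1 @ rest"
    unfolding rest_def by (metis concat.simps(2) list.simps(9))
  then show ?thesis
    unfolding encode_def
    by (simp add: encode_set_def n_def dists_def dl_def rl_def r2l_def sl_def)
qed

lemma input_n: "input 1 = int n"
  using array_of_segment[of 0 "[int n]" "[]"] by (simp add: input_def encode_split)

lemma input_dist:
  assumes "x < n" "y < n"
  defines "e \<equiv> int n * int x + int y"
  shows "input (2 + (e + e)) = fst (quotient_of (distance I (pts ! x) (pts ! y)))"
    and "input (3 + (e + e)) = snd (quotient_of (distance I (pts ! x) (pts ! y)))"
proof -
  have "n * x + y < n * n"
  proof -
    have "n * x + y < n * x + n" using assms by simp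
    also have "\<dots> = n * (x + 1)" by simp
    also have "\<dots> \<le> n * n" using assms by (intro mult_left_mono) auto
    finally show ?thesis .
  qed
  then have l: "2 * (n * x + y) + j < length dists" if "j < 2" for j
    unfolding dists_length using that by simp
  have "input (int (length [int n]) + 1 + int (2 * (n * x + y) + j)) = 
      encode_rat (distance I (pts ! x) (pts ! y)) ! j" if "j < 2" for j
    unfolding input_def encode_split array_of_segment[OF l[OF that]]
    using dists_nth assms that by simp
  from this[of 0] this[of 1]
  show "input (2 + (e + e)) = fst (quotient_of (distance I (pts ! x) (pts ! y)))"
    "input (3 + (e + e)) = snd (quotient_of (distance I (pts ! x) (pts ! y)))"
    by (simp_all add: encode_rat_def e_def algebra_simps)
qed

lemma input_segment:
  assumes "encode pts I = xs @ ys @ zs" "j < length ys"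
  shows "input (int (length xs) + 1 + int j) = ys ! j"
  unfolding input_def assms(1) by (rule array_of_segment[OF assms(2)])

lemma input_drivers:
  "input base_d = int (length dl)"
  "j < length dl \<Longrightarrow> input (base_d + (1 + int j)) = dl ! j"
proof -
  let ?xs = "[int n] @ dists"
  have E: "encode pts I = ?xs @ (int (length dl) # dl) @ ((int (length rl) # rl) @
     (int (length r2l) # r2l) @ (int (length (scenarios I)) # int (length sl) # sl) @ rest)"
    by (simp add: encode_split)
  have b: "base_d = int (length ?xs) + 1" by (simp add: base_d_def dists_length algebra_simps)
  show "input base_d = int (length dl)" using input_segment[OF E, of 0] by (simp add: b)
  show "input (base_d + (1 + int j)) = dl ! j" if "j < length dl"
    using input_segment[OF E, of "Suc j"] that by (simp add: b add.assoc)
qed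

lemma input_riders1:
  "input base_r = int (length rl)"
  "j < length rl \<Longrightarrow> input (base_r + (1 + int j)) = rl ! j"
proof -
  let ?xs = "[int n] @ dists @ (int (length dl) # dl)"
  have E: "encode pts I = ?xs @ (int (length rl) # rl) @
     ((int (length r2l) # r2l) @ (int (length (scenarios I)) # int (length sl) # sl) @ rest)"
    by (simp add: encode_split)
  have b: "base_r = int (length ?xs) + 1"
    by (simp add: base_r_def base_d_def dists_length algebra_simps)
  show "input base_r = int (length rl)" using input_segment[OF E, of 0] by (simp add: b)
  show "input (base_r + (1 + int j)) = rl ! j" if "j < length rl"
    using input_segment[OF E, of "Suc j"] that by (simp add: b add.assoc)
qed

lemma input_riders2: "input (base_r + (int (length rl) + 1)) = int (length r2l)"
proof -
  let ?xs = "[int n] @ dists @ (int (length dl) # dl) @ (int (length rl) # rl)"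
  have E: "encode pts I = ?xs @
     (int (length r2l) # r2l) @ ((int (length (scenarios I)) # int (length sl) # sl) @ rest)"
    by (simp add: encode_split)
  have b: "base_r + (int (length rl) + 1) = int (length ?xs) + 1"
    by (simp add: base_r_def base_d_def dists_length algebra_simps)
  show ?thesis unfolding b using input_segment[OF E, of 0] by simp
qed

lemma input_scenario:
  "j < length sl \<Longrightarrow> input (base_s + (2 + int j)) = sl ! j"
proof -
  let ?xs = "[int n] @ dists @ (int (length dl) # dl) @ (int (length rl) # rl) @
     (int (length r2l) # r2l)"
  have E: "encode pts I = ?xs @ (int (length (scenarios I)) # int (length sl) # sl) @ rest"
    by (simp add: encode_split)
  have b: "base_s = int (length ?xs) + 1"
    by (simp add: base_s_def base_r_def base_d_def dists_length algebra_simps)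
  show "input (base_s + (2 + int j)) = sl ! j" if "j < length sl"
    using input_segment[OF E, of "Suc (Suc j)"] that by (simp add: b add.assoc)
qed

text \<open>A \<open>For_upto\<close> loop runs as often as there are input numbers, so its limit
  must not exceed \<open>input 0\<close>; the limits that occur are the number of drivers and
  \<open>n * n\<close>.\<close>

lemma input_length:
  "int (length dl) \<le> input 0" "int n * int n \<le> input 0" "0 \<le> input 0"
proof -
  have "input 0 = int (length (encode pts I))" by (simp add: input_def array_of_def)
  moreover have "length dl + length dists \<le> length (encode pts I)" by (simp add: encode_split)
  ultimately have "int (length dl + length dists) \<le> input 0" by (simp only: of_nat_le_iff)
  then have "int (length dl) + 2 * (int n * int n) \<le> input 0" by (simp add: dists_length)
  moreover have "0 \<le> int n * int n" by simp
  ultimately show "int (length dl) \<le> input 0" "int n * int n \<le> input 0" "0 \<le> input 0"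
    by linarith+
qed

lemma length_index_list: "A \<subseteq> set pts \<Longrightarrow> length (index_list pts A) = card A"
  using bij_betw_same_card[OF index_list_bij[OF points_subset(4)]] by simp

text \<open>This is zero surplus: the cost matrix is square.\<close>

lemma rows_count: "length rl + length sl = length dl"
proof -
  have "card S1 = k" using S1 inst(2) by (simp add: uniform_scenarios_def)
  then show ?thesis using inst(3) points_subset
    by (simp add: rl_def sl_def dl_def length_index_list surplus_def)
qed

definition N :: int where "N = int (length dl)"
definition R :: int where "R = int (length rl)"
definition rows :: "int list" where "rows = rl @ sl"

lemma R_bounds: "0 \<le> R" "R \<le> N" and rows_length: "int (length rows) = N"
  using rows_count by (auto simp: R_def N_def rows_def)

definition row :: "int \<Rightarrow> 'a" where "row i = pts ! nat (rows ! nat i)"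
definition col :: "int \<Rightarrow> 'a" where "col j = pts ! nat (dl ! nat j)"

lemma col_bij: "bij_betw col {0..<N} (drivers I)"
  using bij_betw_trans[OF bij_betw_int_lessThan index_list_bij[OF points_subset(4,1)]]
  by (simp add: col_def[abs_def] dl_def N_def o_def)

lemma row_bij1: "bij_betw row {0..<R} (riders1 I)"
proof -
  have "bij_betw ((\<lambda>j. pts ! nat (rl ! j)) \<circ> nat) {0..<R} (riders1 I)"
    using bij_betw_trans[OF bij_betw_int_lessThan index_list_bij[OF points_subset(4,2)]]
    by (simp add: rl_def R_def)
  then show ?thesis
    by (rule iffD1[OF bij_betw_cong, rotated]) (auto simp: row_def rows_def R_def nth_append)
qed

lemma row_bij2: "bij_betw row {R..<N} S1"
proof -
  have "bij_betw (\<lambda>i. nat (i - R)) {R..<N} {..<length sl}"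
    by (rule bij_betw_byWitness[where f' = "\<lambda>j. int j + R"]) (use rows_count in \<open>auto simp: R_def N_def\<close>)
  then have "bij_betw ((\<lambda>j. pts ! nat (sl ! j)) \<circ> (\<lambda>i. nat (i - R))) {R..<N} S1"
    using bij_betw_trans[OF _ index_list_bij[OF points_subset(4,3)]] by (simp add: sl_def)
  then show ?thesis
    by (rule iffD1[OF bij_betw_cong, rotated])
      (auto simp: row_def rows_def R_def nth_append nat_diff_distrib)
qed

lemma index_bounds:
  "0 \<le> i \<Longrightarrow> i < N \<Longrightarrow> 0 \<le> rows ! nat i \<and> nat (rows ! nat i) < n"
  "0 \<le> j \<Longrightarrow> j < N \<Longrightarrow> 0 \<le> dl ! nat j \<and> nat (dl ! nat j) < n"
proof -
  show "0 \<le> rows ! nat i \<and> nat (rows ! nat i) < n" if "0 \<le> i" "i < N"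
  proof -
    have "rows ! nat i \<in> set rl \<union> set sl"
      using that rows_length nth_mem[of "nat i" rows] by (auto simp: rows_def)
    then show ?thesis using index_list_range by (auto simp: n_def rl_def sl_def)
  qed
  show "0 \<le> dl ! nat j \<and> nat (dl ! nat j) < n" if "0 \<le> j" "j < N"
  proof -
    have "dl ! nat j \<in> set dl" using that by (auto simp: N_def)
    then show ?thesis using index_list_range by (auto simp: n_def dl_def)
  qed
qed

definition den :: "'a \<Rightarrow> 'a \<Rightarrow> int" where "den x y = snd (quotient_of (distance I x y))"
definition num :: "'a \<Rightarrow> 'a \<Rightarrow> int" where "num x y = fst (quotient_of (distance I x y))"

lemma den_pos: "0 < den x y"
  unfolding den_def by (rule quotient_of_denom_pos')

lemma distance_fraction: "of_int (num x y) = distance I x y * of_int (den x y)"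
proof -
  have "distance I x y = of_int (num x y) / of_int (den x y)"
    unfolding num_def den_def by (rule quotient_of_div) simp
  then show ?thesis using den_pos[of x y] by (simp add: field_simps)
qed

definition s1 :: state where "s1 = sem locate (initial_state (encode pts I))"
definition s2 :: state where "s2 = sem common_denominator s1"
definition s3 :: state where "s3 = sem fill_rows s2"
definition Q :: int where "Q = s2 ''q'' 0"

lemma s1: "s1 ''in'' = input" "s1 ''w'' 0 = int n * int n" "s1 ''b'' 0 = base_d" "s1 ''N'' 0 = N"
  "s1 ''a'' 0 = base_r" "s1 ''R'' 0 = R" "s1 ''z'' 0 = base_s" "s1 ''q'' 0 = 1"
  "z \<notin> {''in'', ''w'', ''b'', ''N'', ''a'', ''R'', ''z'', ''q''} \<Longrightarrow> s1 z i = 0"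
proof -
  have 0: "initial_state (encode pts I) ''in'' = input"
    by (simp add: initial_state_def input_def)
  note a = input_n input_drivers(1) input_riders1(1) input_riders2
  show "s1 ''in'' = input" by (simp add: s1_def sem_frame 0)
  show w: "s1 ''w'' 0 = int n * int n" by (simp add: s1_def locate_def 0 a)
  show "s1 ''b'' 0 = base_d" by (simp add: s1_def locate_def 0 a base_d_def)
  show "s1 ''N'' 0 = N"
    using a(2) by (simp add: s1_def locate_def 0 a(1) base_d_def N_def)
  show "s1 ''a'' 0 = base_r"
    using a(2) by (simp add: s1_def locate_def 0 a(1) base_d_def base_r_def)
  show "s1 ''R'' 0 = R"
    using a(2,3) by (simp add: s1_def locate_def 0 a(1) base_d_def base_r_def R_def)
  show "s1 ''z'' 0 = base_s"
    using a(2,3,4) by (simp add: s1_def locate_def 0 a(1) base_d_def base_r_def base_s_def)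
  show "s1 ''q'' 0 = 1" by (simp add: s1_def locate_def)
  show "s1 z i = 0" if "z \<notin> {''in'', ''w'', ''b'', ''N'', ''a'', ''R'', ''z'', ''q''}"
    using that by (simp add: s1_def sem_frame initial_state_def)
qed

lemma Q: "0 < Q" "x < n \<Longrightarrow> y < n \<Longrightarrow> den (pts ! x) (pts ! y) dvd Q"
proof -
  let ?I = "\<lambda>i s. 0 < s ''q'' 0 \<and> (\<forall>x<n. \<forall>y<n. int n * int x + int y < i \<longrightarrow>
      den (pts ! x) (pts ! y) dvd s ''q'' 0)"
  have "?I (s1 ''w'' 0) s2"
    unfolding s2_def common_denominator_def
  proof (rule For_upto_rule[where I = ?I])
    show "0 \<le> s1 ''w'' 0" "s1 ''w'' 0 \<le> s1 ''in'' 0" using input_length by (simp_all add: s1)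
    have "\<not> int n * int x + int y < 0" for x y by (simp add: not_less)
    then show "?I 0 s1" by (simp add: s1)
  next
    fix i r
    let ?body = "assign ''q'' (Mul (Cell ''in'' (Add (Lit 3) (Add (scalar ''x'') (scalar ''x''))))
      (scalar ''q''))"
    assume i: "0 \<le> i" "i < s1 ''w'' 0" and I: "?I i r" and x: "r ''x'' 0 = i"
      and fr: "\<And>z. z \<notin> insert ''x'' (writes ?body) \<Longrightarrow> r z = s1 z"
    have "r ''in'' = input" using fr[of "''in''"] by (simp add: s1)
    then have q: "sem ?body r ''q'' 0 = input (3 + (i + i)) * r ''q'' 0" by (simp add: x)
    \<comment> \<open>Decoding the position \<open>i\<close> identifies the new factor as a
      denominator, so that \<open>q\<close> stays positive.\<close>
    define x' y' where "x' = nat i div n" and "y' = nat i mod n"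
    have "nat i < n * n" using i by (simp add: s1 nat_less_iff)
    then have xy: "x' < n" "y' < n" "n * x' + y' = nat i"
      by (auto simp: x'_def y'_def less_mult_imp_div_less) (metis gr_implies_not0 mod_less_divisor mult_is_0 not_gr_zero)
    then have i_eq: "int n * int x' + int y' = i"
      using i(1) by (metis int_nat_eq of_nat_add of_nat_mult)
    then have d: "input (3 + (i + i)) = den (pts ! x') (pts ! y')"
      using input_dist(2)[OF xy(1,2)] by (simp add: den_def)
    have "den (pts ! x) (pts ! y) dvd input (3 + (i + i)) * r ''q'' 0"
      if xy': "x < n" "y < n" "int n * int x + int y < i + 1" for x y
    proof (cases "int n * int x + int y = i")
      case True
      then have "input (3 + (i + i)) = den (pts ! x) (pts ! y)"
        using input_dist(2)[OF xy'(1,2)] by (simp add: den_def)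
      then show ?thesis by simp
    next
      case False
      then show ?thesis using I that by (auto intro: dvd_mult)
    qed
    then show "?I (i + 1) (sem ?body r)" using I q d den_pos by simp
  qed auto
  then have I: "?I (int n * int n) s2" by (simp add: s1)
  then show "0 < Q" by (simp add: Q_def)
  show "den (pts ! x) (pts ! y) dvd Q" if xy: "x < n" "y < n"
  proof -
    have "n * x + y < n * x + n" using xy by simp
    also have "\<dots> = n * (x + 1)" by simp
    also have "\<dots> \<le> n * n" using xy by (intro mult_left_mono) auto
    finally have "int n * int x + int y < int n * int n" by (metis of_nat_add of_nat_less_iff of_nat_mult)
    then show ?thesis using I xy by (simp add: Q_def)
  qed
qed

lemma s2: "s2 ''in'' = input" "s2 ''b'' 0 = base_d" "s2 ''N'' 0 = N"
  "s2 ''a'' 0 = base_r" "s2 ''R'' 0 = R" "s2 ''z'' 0 = base_s" "s2 ''q'' 0 = Q"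
  "z \<notin> {''in'', ''w'', ''b'', ''N'', ''a'', ''R'', ''z'', ''q'', ''x''} \<Longrightarrow> s2 z i = 0"
  using s1 by (simp_all add: s2_def sem_frame Q_def)

text \<open>The last clause provides the cleared work arrays from which the Hungarian method starts,
  and the empty output list.\<close>

lemma s3: "s3 ''in'' = input" "s3 ''b'' 0 = base_d" "s3 ''N'' 0 = N" "s3 ''R'' 0 = R"
  "z \<notin> {''in'', ''w'', ''b'', ''N'', ''a'', ''R'', ''z'', ''q'', ''x'', ''s'', ''l''} \<Longrightarrow> s3 z i = 0"
  using s2 by (simp_all add: s3_def sem_frame)

lemma s3_rows:
  assumes "0 \<le> i" "i < N"
  shows "s3 ''s'' i = rows ! nat i" "s3 ''l'' i = (if i < R then 3 else 1) * Q"
proof -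
  let ?I = "\<lambda>n s. \<forall>i. 0 \<le> i \<and> i < n \<longrightarrow>
    s ''s'' i = rows ! nat i \<and> s ''l'' i = (if i < R then 3 else 1) * Q"
  have "?I (s2 ''N'' 0) s3"
    unfolding s3_def fill_rows_def
  proof (rule For_upto_rule[where I = ?I])
    show "0 \<le> s2 ''N'' 0" "s2 ''N'' 0 \<le> s2 ''in'' 0" using input_length by (simp_all add: s2 N_def)
    show "?I 0 s2" by simp
  next
    fix j r
    let ?body = "Branch (Less (scalar ''x'') (scalar ''R''))
      (Block (Assign ''s'' (scalar ''x'') (Cell ''in'' (Add (scalar ''a'') (Add (Lit 1) (scalar ''x'')))))
         (Assign ''l'' (scalar ''x'') (Add (scalar ''q'') (Add (scalar ''q'') (scalar ''q'')))))
      (Block (Assign ''s'' (scalar ''x'')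
            (Cell ''in'' (Add (scalar ''z'') (Add (Lit 2) (Sub (scalar ''x'') (scalar ''R''))))))
         (Assign ''l'' (scalar ''x'') (scalar ''q'')))"
    assume j: "0 \<le> j" "j < s2 ''N'' 0" and I: "?I j r" and x: "r ''x'' 0 = j"
      and fr: "\<And>z. z \<notin> insert ''x'' (writes ?body) \<Longrightarrow> r z = s2 z"
    have r: "r ''in'' = s2 ''in''" "r ''a'' = s2 ''a''" "r ''R'' = s2 ''R''" "r ''z'' = s2 ''z''"
      "r ''q'' = s2 ''q''"
      by (rule fr; simp)+
    have jN: "j < N" using j by (simp add: s2)
    have "sem ?body r ''s'' j = rows ! nat j \<and> sem ?body r ''l'' j = (if j < R then 3 else 1) * Q"
    proof (cases "j < R")
      case True
      then have "input (base_r + (1 + j)) = rows ! nat j"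
        using input_riders1(2)[of "nat j"] j by (simp add: rows_def nth_append R_def nat_less_iff)
      then show ?thesis using True by (simp add: x r s2)
    next
      case False
      have "nat (j - R) < length sl" using False j jN rows_count by (auto simp: R_def N_def)
      moreover have "nat j - length rl = nat (j - R)" using False by (simp add: R_def nat_diff_distrib)
      ultimately have "input (base_s + (2 + (j - R))) = rows ! nat j"
        using input_scenario[of "nat (j - R)"] False j
        by (simp add: rows_def nth_append R_def nat_less_iff)
      then show ?thesis using False by (simp add: x r s2)
    qed
    moreover have "sem ?body r ''s'' i = r ''s'' i" "sem ?body r ''l'' i = r ''l'' i" if "i \<noteq> j" for i
      using that by (simp_all add: x)
    ultimately show "?I (j + 1) (sem ?body r)" using I
      by (metis order_le_less zless_add1_eq)
  qed auto
  then show "s3 ''s'' i = rows ! nat i" "s3 ''l'' i = (if i < R then 3 else 1) * Q"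
    using assms by (simp_all add: s2)
qed

definition C :: "int \<Rightarrow> int \<Rightarrow> int" where
  "C i j = num (row i) (col j) * ((if i < R then 3 else 1) * Q div den (row i) (col j))"

text \<open>Every denominator divides \<open>Q\<close>, so the integer division in \<open>C\<close>
  loses nothing and \<open>C\<close> is the weighted distance scaled by \<open>Q\<close>.\<close>

lemma C_distance:
  assumes "0 \<le> i" "i < N" "0 \<le> j" "j < N"
  shows "of_int (C i j) = of_int Q * ((if i < R then 3 else 1) * distance I (row i) (col j))"
proof -
  let ?w = "if i < R then 3 else 1" and ?e = "den (row i) (col j)"
  have "?e dvd Q" unfolding row_def col_def using index_bounds assms by (intro Q(2)) auto
  then obtain c where c: "Q = ?e * c" ..
  then have "?w * Q div ?e = ?w * c" using den_pos[of "row i" "col j"] by simp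
  then have "of_int (C i j) = distance I (row i) (col j) * of_int (?e * (?w * c))"
    by (simp add: C_def distance_fraction)
  also have "?e * (?w * c) = Q * ?w" by (subst c) simp
  finally show ?thesis by simp
qed

lemma C_nonneg:
  assumes "0 \<le> i" "i < N" "0 \<le> j" "j < N"
  shows "0 \<le> C i j"
proof -
  have "row i \<in> riders1 I \<union> S1"
    using bij_betwE[OF row_bij1] bij_betwE[OF row_bij2] assms by (cases "i < R") auto
  then have "row i \<in> points I" using inst(1) S1 by (auto simp: points_def tsrm_instance_def)
  moreover have "col j \<in> points I"
    using bij_betwE[OF col_bij] assms by (auto simp: points_def)
  ultimately have "0 \<le> distance I (row i) (col j)"
    using inst(1) by (simp add: tsrm_instance_def metric_on_def)
  then have "0 \<le> (of_int (C i j) :: rat)" using C_distance[OF assms] Q(1) by simp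
  then show ?thesis by simp
qed

definition Z :: "vname set" where "Z = {''in'', ''N'', ''s'', ''l'', ''b''}"

lemma edge_cost:
  assumes s: "\<And>z. z \<in> Z \<Longrightarrow> s z = s3 z"
    and ij: "0 \<le> s ''i'' 0" "s ''i'' 0 < N" "0 \<le> s ''j'' 0" "s ''j'' 0 < N"
  shows "aval edge_cost s = C (s ''i'' 0) (s ''j'' 0)"
proof -
  define i j where "i = s ''i'' 0" and "j = s ''j'' 0"
  have z: "s ''in'' = input" "s ''s'' = s3 ''s''" "s ''l'' = s3 ''l''" "s ''b'' 0 = base_d"
    using s by (simp_all add: Z_def s3)
  have d: "input (base_d + (1 + j)) = dl ! nat j"
    using input_drivers(2)[of "nat j"] ij by (simp add: j_def N_def nat_less_iff)
  define x y where "x = nat (rows ! nat i)" and "y = nat (dl ! nat j)"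
  have x: "x < n" "int x = rows ! nat i" and y: "y < n" "int y = dl ! nat j"
    using index_bounds ij by (auto simp: x_def y_def i_def j_def)
  have "row i = pts ! x" "col j = pts ! y" by (simp_all add: row_def col_def x_def y_def)
  then show ?thesis
    using input_dist[OF x(1) y(1)] x(2) y(2) s3_rows[of i] ij d
    by (simp add: edge_cost_def Let_def z input_n i_def[symmetric] j_def[symmetric] C_def num_def den_def)
qed

sublocale hungarian_run N C edge_cost Z s3
proof
  show "0 \<le> N" by (simp add: N_def)
  show "''in'' \<in> Z" "''N'' \<in> Z" "Z \<inter> work_vars = {}" by (auto simp: Z_def work_vars_def)
  show "s3 ''N'' 0 = N" "N \<le> s3 ''in'' 0" using input_length by (simp_all add: s3 N_def)
qed (use C_nonneg edge_cost in auto)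

definition s4 :: state where "s4 = sem (hungarian edge_cost) s3"
definition D1 :: "'a set" where "D1 = col ` s4 ''m'' ` {0..<R}"

lemma s4: "solved N s4"
  unfolding s4_def by (rule hungarian_solved) (auto simp: fixed_def work_vars_def intro!: s3)

lemma s4_frame: "s4 ''in'' = input" "s4 ''b'' 0 = base_d" "s4 ''N'' 0 = N" "s4 ''R'' 0 = R"
  "s4 ''out'' 0 = 0"
  using s3 by (simp_all add: s4_def sem_frame work_vars_def)

lemma s4_matching: "bij_betw (s4 ''m'') {0..<N} {0..<N}"
  "bij_betw f {0..<N} {0..<N} \<Longrightarrow>
    (\<Sum>i\<in>{0..<N}. C i (s4 ''m'' i)) \<le> (\<Sum>i\<in>{0..<N}. C i (f i))"
  using s4 matched_optimal[of "s4 ''p''" "s4 ''u''" "s4 ''o''" "s4 ''m''"] bij_betw_id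
  unfolding solved_def by blast+

lemma D1_approximation: "feasible I D1" "total_cost I D1 \<le> 2 * OPT I" "0 \<le> OPT I"
  unfolding D1_def
  using optimal_assignment_two_approximation[OF inst S1 R_bounds row_bij1 row_bij2 col_bij _
      C_distance s4_matching] Q(1) by auto

lemma chosen_iff:
  assumes "0 \<le> j" "j < N"
  shows "s4 ''o'' j < R + 1 \<longleftrightarrow> col j \<in> D1"
proof -
  have ma: "matched N (- 1) (s4 ''p'') (s4 ''u'') (s4 ''o'') (s4 ''m'')"
    using s4 by (simp add: solved_def)
  have "j \<in> s4 ''m'' ` {0..<N}" using s4_matching(1) assms by (auto simp: bij_betw_def)
  then obtain i where i: "i \<in> {0..<N}" "j = s4 ''m'' i" by auto
  then have o: "s4 ''o'' j = i + 1" using ma by (auto simp: matched_def)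
  have "col j \<in> D1 \<longleftrightarrow> j \<in> s4 ''m'' ` {0..<R}"
    unfolding D1_def using col_bij s4_matching(1) R_bounds assms
    by (intro inj_on_image_mem_iff[of col "{0..<N}"]) (auto simp: bij_betw_def)
  also have "\<dots> \<longleftrightarrow> i \<in> {0..<R}"
    unfolding i(2) using s4_matching(1) R_bounds i(1)
    by (intro inj_on_image_mem_iff[of _ "{0..<N}"]) (auto simp: bij_betw_def)
  finally show ?thesis using i(1) o by auto
qed

lemma holds_list_snoc:
  assumes "holds_list h ys"
  shows "holds_list (h(0 := h 0 + 1, h 0 + 1 := v)) (ys @ [v])"
  using assms by (auto simp: holds_list_def nth_append less_Suc_eq)

text \<open>Columns are visited in the order of \<open>dl\<close>, and filtering \<open>dl\<close>
  by membership in \<open>D1\<close> gives exactly \<open>index_list pts D1\<close>, as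
  \<open>D1\<close> consists of drivers.\<close>

lemma emit_result: "holds_list (sem emit s4 ''out'') (index_list pts D1)"
proof -
  let ?I = "\<lambda>i s. holds_list (s ''out'') (filter (\<lambda>z. pts ! nat z \<in> D1) (take (nat i) dl))"
  have "?I (s4 ''N'' 0) (sem emit s4)"
    unfolding emit_def
  proof (rule For_upto_rule[where I = ?I])
    show "0 \<le> s4 ''N'' 0" "s4 ''N'' 0 \<le> s4 ''in'' 0"
      using input_length by (simp_all add: s4_frame N_def)
    show "?I 0 s4" by (simp add: holds_list_def s4_frame)
  next
    fix j r
    let ?body = "Branch (Less (Cell ''o'' (scalar ''x'')) (Add (scalar ''R'') (Lit 1)))
          (Block (assign ''out'' (Add (scalar ''out'') (Lit 1)))
             (Assign ''out'' (scalar ''out'')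
                (Cell ''in'' (Add (scalar ''b'') (Add (Lit 1) (scalar ''x''))))))
          Nop"
    assume j: "0 \<le> j" "j < s4 ''N'' 0" and I: "?I j r" and x: "r ''x'' 0 = j"
      and fr: "\<And>z. z \<notin> insert ''x'' (writes ?body) \<Longrightarrow> r z = s4 z"
    have r: "r ''in'' = s4 ''in''" "r ''o'' = s4 ''o''" "r ''R'' = s4 ''R''" "r ''b'' = s4 ''b''"
      by (rule fr; simp)+
    have jN: "j < N" "nat j < length dl" using j by (auto simp: s4_frame N_def nat_less_iff)
    have "nat (j + 1) = Suc (nat j)" using j by simp
    then have take: "take (nat (j + 1)) dl = take (nat j) dl @ [dl ! nat j]"
      using jN by (simp add: take_Suc_conv_app_nth)
    have v: "input (base_d + (1 + j)) = dl ! nat j"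
      using input_drivers(2)[of "nat j"] j jN by simp
    show "?I (j + 1) (sem ?body r)"
    proof (cases "s4 ''o'' j < R + 1")
      case True
      then have "pts ! nat (dl ! nat j) \<in> D1" using chosen_iff[OF j(1) jN(1)] by (simp add: col_def)
      moreover have "sem ?body r ''out'' =
          (r ''out'')(0 := r ''out'' 0 + 1, r ''out'' 0 + 1 := dl ! nat j)"
        using True by (simp add: x r s4_frame v)
      ultimately show ?thesis using holds_list_snoc[OF I] take by simp
    next
      case False
      then have "pts ! nat (dl ! nat j) \<notin> D1" using chosen_iff[OF j(1) jN(1)] by (simp add: col_def)
      then show ?thesis using I take False by (simp add: x r s4_frame)
    qed
  qed auto
  moreover have "index_list pts D1 = filter (\<lambda>z. pts ! nat z \<in> D1) dl"
    unfolding dl_def using D1_approximation(1) by (intro index_list_subset) (simp add: feasible_def)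
  ultimately show ?thesis by (simp add: s4_frame N_def)
qed

lemma matching_program_outputs: "outputs (compile matching_program) (encode pts I) (index_list pts D1)"
proof (rule outputs_compile[OF wf_matching_program])
  have "sem matching_program (initial_state (encode pts I)) = sem emit s4"
    by (simp add: matching_program_def s4_def s3_def s2_def s1_def)
  then show "holds_list (sem matching_program (initial_state (encode pts I)) ''out'') (index_list pts D1)"
    using emit_result by simp
qed

end

theorem theorem11:
  "\<exists>P :: com.
     polynomial_time_on P
       {encode pts I | pts (I :: nat tsrm).
          tsrm_instance I \<and> (\<exists>k. uniform_scenarios I k) \<and> enumerates pts I} \<and>
     (\<forall>(I :: nat tsrm) k pts.
        tsrm_instance I \<and> uniform_scenarios I k \<and> surplus I k = 0 \<and> enumerates pts I \<longrightarrow>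
        (\<exists>D1. outputs P (encode pts I) (index_list pts D1) \<and>
              feasible I D1 \<and> total_cost I D1 \<le> 7 / 3 * OPT I))"
proof (intro exI[of _ "compile matching_program"] conjI allI impI)
  show "polynomial_time_on (compile matching_program)
       {encode pts I | pts (I :: nat tsrm).
          tsrm_instance I \<and> (\<exists>k. uniform_scenarios I k) \<and> enumerates pts I}"
    by (rule polynomial_time_compile[OF wf_matching_program])
  fix I :: "nat tsrm" and k pts
  assume "tsrm_instance I \<and> uniform_scenarios I k \<and> surplus I k = 0 \<and> enumerates pts I"
  then interpret encoded_instance I pts k by unfold_locales auto
  \<comment> \<open>The factor 2 is relaxed to 7/3, which is sound because \<open>OPT I\<close> is
    nonnegative.\<close>
  have "total_cost I D1 \<le> 7 / 3 * OPT I" using D1_approximation by simp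
  then show "\<exists>D1. outputs (compile matching_program) (encode pts I) (index_list pts D1) \<and>
      feasible I D1 \<and> total_cost I D1 \<le> 7 / 3 * OPT I"
    using matching_program_outputs D1_approximation(1) by blast
qed

end
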